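(* Let $A \in M_m(\mathbb{C})$ and let $\{a_1, \ldots, a_k\}$ be the set of moduli of eigenvalues of $A$, where $0 \le a_1 < a_2 < \cdots < a_k$. Let $A = D + N$ be the Jordan-Chevalley decomposition of $A$ into its commuting diagonalizable and nilpotent parts ($D$ and $N$, respectively). For $1 \le j \le k$, let $E_j$ be the orthogonal projection onto the subspace of $\mathbb{C}^m$ spanned by the eigenvectors of $D$ corresponding to eigenvalues with modulus less than or equal to $a_j$, and set $E_0 := 0$. Then the following assertions hold: (i) The sequence $\{|A^n|^{\frac{1}{n}}\}_{n \in \mathbb{N}}$ converges to the positive-semidefinite matrix $\sum_{j=1}^k a_j (E_j - E_{j-1})$. (ii) For every $1 \le j \le k$, a non-zero vector $\vec{x} \in \mathbb{C}^m$ is in $\mathrm{ran}(E_j) \setminus \mathrm{ran}(E_{j-1})$ if and only if $\lim_{n \to \infty} \|A^n \vec{x}\|^{\frac{1}{n}} = a_j$. (iii) For every $1 \le j \le k$, the set $\mathrm{ran}(E_j) \setminus \mathrm{ran}(E_{j-1})$ is invariant under the action of $A^{\ell}$ for every $\ell \in \mathbb{N}$.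
   Context: $\mathbb{N}$ denotes the positive integers. $M_m(\mathbb{C})$ is the set of $m \times m$ complex matrices acting on $\mathbb{C}^m$ with its standard inner product and Euclidean norm $\|\cdot\|$. For $T \in M_m(\mathbb{C})$, $|T| := \sqrt{T^*T}$, and powers of positive-semidefinite matrices are taken via the functional calculus. $\mathrm{ran}(T)$ denotes the range of $T$ in $\mathbb{C}^m$. Convergence of matrices is in norm. A set $S \subseteq \mathbb{C}^m$ is invariant under $B$ if $B\vec{x} \in S$ for every $\vec{x} \in S$.
   Formalization: Part (iii) is false when a_1 = 0 and j = 1 (e.g. m = 1, A = 0: the set C\{0} is sent to 0); in that case invariance under A^ℓ is stated for ran(E_1)\ran(E_0) with the zero vector adjoined; for a_j > 0 it is as printed. *)

theory Defs
  imports "HOL-Analysis.Analysis"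
begin

(* Not A ^ n: the power on the vec type is taken entrywise. *)
primrec matpow :: "complex^'n^'n \<Rightarrow> nat \<Rightarrow> complex^'n^'n" where
  "matpow A 0 = mat 1"
| "matpow A (Suc n) = A ** matpow A n"

definition matrix_range :: "complex^'n^'n \<Rightarrow> (complex^'n) set" where
  "matrix_range T = range (\<lambda>x. T *v x)"

definition invariant_under :: "complex^'n^'n \<Rightarrow> (complex^'n) set \<Rightarrow> bool" where
  "invariant_under B S \<longleftrightarrow> (\<forall>x\<in>S. B *v x \<in> S)"

(* The library's inner on complex^'n is the real part of this one. *)
definition cinner :: "complex^'n \<Rightarrow> complex^'n \<Rightarrow> complex" where
  "cinner x y = (\<Sum>i\<in>UNIV. x $ i * cnj (y $ i))"

definition cadjoint :: "complex^'n^'n \<Rightarrow> complex^'n^'n" where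
  "cadjoint T = (\<chi> i j. cnj (T $ j $ i))"

definition psd :: "complex^'n^'n \<Rightarrow> bool" where
  "psd T \<longleftrightarrow> (\<forall>x. cinner (T *v x) x \<in> \<real> \<and> 0 \<le> Re (cinner (T *v x) x))"

definition eigenvector :: "complex^'n^'n \<Rightarrow> complex^'n \<Rightarrow> complex \<Rightarrow> bool" where
  "eigenvector T v l \<longleftrightarrow> v \<noteq> 0 \<and> T *v v = l *s v"

definition eigenvalue :: "complex^'n^'n \<Rightarrow> complex \<Rightarrow> bool" where
  "eigenvalue T l \<longleftrightarrow> (\<exists>v. eigenvector T v l)"

definition diagonalizable :: "complex^'n^'n \<Rightarrow> bool" where
  "diagonalizable T \<longleftrightarrow>
     (\<exists>P L :: complex^'n^'n. invertible P \<and> (\<forall>i j. i \<noteq> j \<longrightarrow> L $ i $ j = 0) \<and> T = P ** L ** matrix_inv P)"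

definition nilpotent :: "complex^'n^'n \<Rightarrow> bool" where
  "nilpotent T \<longleftrightarrow> (\<exists>n. matpow T n = 0)"

definition jordan_chevalley :: "complex^'n^'n \<Rightarrow> complex^'n^'n \<Rightarrow> complex^'n^'n \<Rightarrow> bool" where
  "jordan_chevalley A D N \<longleftrightarrow>
     A = D + N \<and> D ** N = N ** D \<and> diagonalizable D \<and> nilpotent N"

(* The orthogonal projection onto S, for S a complex linear subspace:
   the unique self-adjoint idempotent with range S. *)
definition orth_proj :: "(complex^'n) set \<Rightarrow> complex^'n^'n" where
  "orth_proj S = (THE P. P ** P = P \<and> cadjoint P = P \<and> matrix_range P = S)"

(* f(T) for Hermitian T, from the spectral decomposition: the sum over the (finitely many, real)
   eigenvalues t of f(t) times the orthogonal projection onto the t-eigenspace. *)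
definition func_calc :: "(real \<Rightarrow> real) \<Rightarrow> complex^'n^'n \<Rightarrow> complex^'n^'n" where
  "func_calc f T =
     (\<Sum>t\<in>{t. eigenvalue T (of_real t)}. f t *\<^sub>R orth_proj {v. T *v v = of_real t *s v})"

definition psd_powr :: "complex^'n^'n \<Rightarrow> real \<Rightarrow> complex^'n^'n" where
  "psd_powr T r = func_calc (\<lambda>t. t powr r) T"

definition matrix_abs :: "complex^'n^'n \<Rightarrow> complex^'n^'n" where
  "matrix_abs T = func_calc sqrt (cadjoint T ** T)"

end

theory Submission
  imports Defs
begin

text \<open>Conjugating \<open>D\<close> to a diagonal matrix gives coordinates in which the spans of eigenvectors of
  \<open>D\<close> are coordinate subspaces, preserved by \<open>N\<close>. A norm adapted to the decomposition makes \<open>N\<close>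
  as small as desired, so \<open>A\<close> grows on each of these subspaces at the rate dictated by the moduli
  of the eigenvalues of \<open>D\<close>; this yields (ii) and (iii).

  For (i) it suffices to consider \<open>x\<close> in the range of \<open>E j - E (j - 1)\<close>. Put
  \<open>X = A\<^sup>n\<close> and decompose \<open>x\<close> along the singular spaces of \<open>X\<close>. The components whose singular value
  exceeds \<open>(a j + \<epsilon>)\<^sup>n\<close> are small because \<open>X x\<close> is not larger than the growth rate of \<open>x\<close> allows.
  The sum \<open>u\<close> of those whose singular value is below \<open>(a j - \<epsilon>)\<^sup>n\<close> is small because
  \<open>(norm u)\<^sup>2 = u \<bullet> x\<close> only involves the part of \<open>u\<close> orthogonal to the range of \<open>E (j - 1)\<close>, which
  \<open>X\<close> would expand faster than it expands \<open>u\<close>.\<close>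

section \<open>Eigenvectors of symmetric operators\<close>

text \<open>The Rayleigh quotient attains its maximum \<open>t\<close> on the compact unit sphere of
  \<open>U\<close>. At a maximiser \<open>v\<close> the residual \<open>h\<close> of the eigenvalue
  equation vanishes, since otherwise moving \<open>v\<close> along the direction of \<open>h\<close>
  would raise the quotient.\<close>

lemma symmetric_eigenvector_exists:
  fixes f :: "'a::euclidean_space \<Rightarrow> 'a"
  assumes lin: "linear f" and sym: "\<And>x y. f x \<bullet> y = x \<bullet> f y"
    and U: "subspace U" "f ` U \<subseteq> U" "U \<noteq> {0}"
  obtains v t where "v \<in> U" "v \<noteq> 0" "f v = t *\<^sub>R v"
proof -
  define K where "K = U \<inter> sphere 0 1"
  obtain w where w: "w \<in> U" "w \<noteq> 0"
    using U subspace_0 by blast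
  have "w /\<^sub>R norm w \<in> K"
    using w U(1) by (simp add: K_def subspace_scale)
  moreover have "compact K"
    unfolding K_def by (rule closed_Int_compact) (auto simp: closed_subspace U)
  moreover have "continuous_on K (\<lambda>x. f x \<bullet> x)"
    by (intro continuous_intros linear_continuous_on_compose[OF _ lin])
  ultimately obtain v where v: "v \<in> K" and vmax: "\<And>x. x \<in> K \<Longrightarrow> f x \<bullet> x \<le> f v \<bullet> v"
    using continuous_attains_sup[of K "\<lambda>x. f x \<bullet> x"] by blast
  define t where "t = f v \<bullet> v"
  have vU: "v \<in> U" and v1: "v \<bullet> v = 1"
    using v by (auto simp: K_def norm_eq_1)
  have quad: "f x \<bullet> x \<le> t * (x \<bullet> x)" if "x \<in> U" for x
  proof (cases "x = 0")
    case True
    then show ?thesis by simp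
  next
    case False
    then have "x /\<^sub>R norm x \<in> K"
      using that U(1) by (simp add: K_def subspace_scale)
    from vmax[OF this] have "(f x \<bullet> x) / (norm x)\<^sup>2 \<le> t"
      by (simp add: t_def linear_scale[OF lin] power2_eq_square divide_inverse mult_ac)
    then show ?thesis
      using False by (simp add: divide_le_eq power2_norm_eq_inner)
  qed
  define h where "h = t *\<^sub>R v - f v"
  have hU: "h \<in> U"
    using U vU by (auto simp: h_def intro: subspace_diff subspace_scale)
  have hv: "h \<bullet> v = 0"
    by (simp add: h_def inner_diff_left v1 t_def)
  have fvh: "f v \<bullet> h = - (h \<bullet> h)"
  proof -
    have "f v = t *\<^sub>R v - h" by (simp add: h_def)
    then show ?thesis
      using hv by (simp add: inner_diff_left inner_diff_right inner_commute)
  qed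
  \<comment> \<open>The form \<open>t * (x \<bullet> x) - f x \<bullet> x\<close> is nonnegative on
    \<open>U\<close> and vanishes at \<open>v\<close>; \<open>c\<close> is its value at
    \<open>h\<close>, hence the second-order coefficient on the line through \<open>v\<close> in
    direction \<open>h\<close>.\<close>
  define c where "c = t * (h \<bullet> h) - f h \<bullet> h"
  have pos: "0 \<le> 2 * s * (h \<bullet> h) + s\<^sup>2 * c" for s :: real
  proof -
    have "v + s *\<^sub>R h \<in> U"
      using U(1) vU hU by (simp add: subspace_add subspace_scale)
    from quad[OF this] show ?thesis
      using fvh hv sym[of h v]
      by (simp add: linear_add[OF lin] linear_scale[OF lin] inner_add_left inner_add_right v1
          c_def power2_eq_square inner_commute algebra_simps)
        (simp add: t_def inner_commute algebra_simps)
  qed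
  have "h \<bullet> h \<le> 0"
  proof (rule ccontr)
    assume "\<not> h \<bullet> h \<le> 0"
    then have hh: "h \<bullet> h > 0" by linarith
    \<comment> \<open>A negative \<open>s\<close> so small that the quadratic term cannot outweigh
      the linear one.\<close>
    define s where "s = - (h \<bullet> h) / (\<bar>c\<bar> + 1)"
    have "s < 0" using hh by (auto simp: s_def divide_neg_pos)
    have "0 \<le> s * (2 * (h \<bullet> h) + s * c)"
      using pos[of s] by (simp add: power2_eq_square algebra_simps)
    then have "2 * (h \<bullet> h) + s * c \<le> 0"
      using \<open>s < 0\<close> by (simp add: zero_le_mult_iff)
    moreover have "- (s * c) \<le> h \<bullet> h"
    proof -
      have "- (s * c) \<le> \<bar>s\<bar> * \<bar>c\<bar>" by (metis abs_ge_minus_self abs_mult)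
      also have "\<dots> = (h \<bullet> h) * (\<bar>c\<bar> / (\<bar>c\<bar> + 1))"
        using hh by (simp add: s_def abs_mult abs_divide)
      also have "\<dots> \<le> (h \<bullet> h) * 1"
        using hh by (intro mult_left_mono) auto
      finally show ?thesis by simp
    qed
    ultimately show False using hh by linarith
  qed
  then have "h = 0"
    using inner_gt_zero_iff[of h] by linarith
  then have "f v = t *\<^sub>R v"
    by (simp add: h_def)
  moreover have "v \<noteq> 0" using v1 by auto
  ultimately show ?thesis using vU that by blast
qed

section \<open>Adjoints and the real inner product\<close>

text \<open>The real part of the usual adjoint identity; it lets self-adjointness be handled through
  the real inner product.\<close>

lemma inner_cadjoint: "(T *v x) \<bullet> y = x \<bullet> (cadjoint T *v y)"
proof -
  have "(T *v x) \<bullet> y = (\<Sum>i\<in>UNIV. \<Sum>j\<in>UNIV. (T$i$j * x$j) \<bullet> y$i)"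
    by (simp add: inner_vec_def matrix_vector_mult_def inner_sum_left)
  also have "\<dots> = (\<Sum>i\<in>UNIV. \<Sum>j\<in>UNIV. x$j \<bullet> (cnj (T$i$j) * y$i))"
    by (simp add: inner_complex_def algebra_simps)
  also have "\<dots> = (\<Sum>j\<in>UNIV. \<Sum>i\<in>UNIV. x$j \<bullet> (cnj (T$i$j) * y$i))"
    by (rule sum.swap)
  also have "\<dots> = x \<bullet> (cadjoint T *v y)"
    by (simp add: inner_vec_def matrix_vector_mult_def inner_sum_right cadjoint_def)
  finally show ?thesis .
qed

lemma cadjoint_cadjoint [simp]: "cadjoint (cadjoint T) = T"
  by (simp add: cadjoint_def vec_eq_iff)

lemma cadjoint_mult: "cadjoint (S ** T) = cadjoint T ** cadjoint S"
  by (simp add: cadjoint_def vec_eq_iff matrix_matrix_mult_def mult.commute)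

text \<open>The real inner product is nondegenerate, so it already determines the complex
  adjoint.\<close>

lemma hermitian_iff_symmetric:
  "cadjoint T = T \<longleftrightarrow> (\<forall>x y. (T *v x) \<bullet> y = x \<bullet> (T *v y))"
proof
  assume *: "\<forall>x y. (T *v x) \<bullet> y = x \<bullet> (T *v y)"
  have "x \<bullet> (cadjoint T *v y) = x \<bullet> (T *v y)" for x y
    by (metis * inner_cadjoint)
  then have "cadjoint T *v y = T *v y" for y
    by (metis vector_eq_ldot)
  then show "cadjoint T = T"
    by (simp add: matrix_eq)
qed (metis inner_cadjoint)

lemma scaleR_eq_of_real_smult: "r *\<^sub>R (x::complex^'n) = of_real r *s x"
  by (simp add: vec_eq_iff complex_eq_iff)

lemma scaleR_matrix_mult_vec: "(r *\<^sub>R (A::complex^'n^'m)) *v x = r *\<^sub>R (A *v x)"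
  by (simp add: vec_eq_iff matrix_vector_mult_def scaleR_sum_right)

lemma matrix_sum_mult_vec: "(\<Sum>i\<in>I. (F i :: complex^'n^'m)) *v x = (\<Sum>i\<in>I. F i *v x)"
  by (induction I rule: infinite_finite_induct) (simp_all add: matrix_vector_mult_add_rdistrib)

section \<open>Orthogonal projections onto complex subspaces\<close>

lemma vec_subspace_imp_subspace:
  assumes "vec.subspace (S :: (complex^'n) set)"
  shows "subspace S"
  using assms by (auto simp: vec.subspace_def subspace_def scaleR_eq_of_real_smult)

lemma inner_smult_cnj: "(c *s x) \<bullet> y = x \<bullet> (cnj c *s (y::complex^'n))"
  by (simp add: inner_vec_def inner_complex_def algebra_simps)

text \<open>A real orthogonal complement of a complex subspace is again a complex subspace, so real
  orthogonal projections are complex linear.\<close>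

lemma orth_proj_exists:
  assumes S: "vec.subspace (S :: (complex^'n) set)"
  shows "\<exists>P. P ** P = P \<and> cadjoint P = P \<and> matrix_range P = S"
proof -
  have rS: "subspace S" by (rule vec_subspace_imp_subspace[OF S])
  have "\<exists>y. y \<in> S \<and> (\<forall>w\<in>S. (x - y) \<bullet> w = 0)" for x
  proof -
    obtain y z where "y \<in> span S" "\<And>w. w \<in> span S \<Longrightarrow> orthogonal z w" "x = y + z"
      using orthogonal_subspace_decomp_exists[of S x] by blast
    then show ?thesis
      using rS by (intro exI[of _ y]) (simp add: orthogonal_def span_eq_iff[THEN iffD2])
  qed
  then obtain p where p: "\<And>x. p x \<in> S" "\<And>x w. w \<in> S \<Longrightarrow> (x - p x) \<bullet> w = 0"
    by metis
  \<comment> \<open>This characterisation of \<open>p x\<close> reduces additivity, complex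
    homogeneity and the fixing of \<open>S\<close> to orthogonality checks.\<close>
  have uniq: "p x = y" if "y \<in> S" "\<And>w. w \<in> S \<Longrightarrow> (x - y) \<bullet> w = 0" for x y
  proof -
    have d: "p x - y \<in> S" using rS p that by (simp add: subspace_diff)
    have "(p x - y) \<bullet> (p x - y) = (x - y) \<bullet> (p x - y) - (x - p x) \<bullet> (p x - y)"
      by (simp add: inner_diff_left)
    also have "\<dots> = 0" using d p that by simp
    finally show ?thesis by simp
  qed
  have add: "p (x + y) = p x + p y" for x y
    by (rule uniq) (use p rS in \<open>auto simp: subspace_add add_diff_add inner_add_left\<close>)
  have scale: "p (c *s x) = c *s p x" for c x
  proof (rule uniq)
    show "c *s p x \<in> S" using p S by (simp add: vec.subspace_scale)
    fix w assume "w \<in> S"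
    then have "cnj c *s w \<in> S" using S by (simp add: vec.subspace_scale)
    moreover have "(c *s x - c *s p x) \<bullet> w = (x - p x) \<bullet> (cnj c *s w)"
      by (metis inner_smult_cnj vector_ssub_ldistrib)
    ultimately show "(c *s x - c *s p x) \<bullet> w = 0" using p by simp
  qed
  have lin: "Vector_Spaces.linear (*s) (*s) p"
    by (simp add: Vector_Spaces.linear_iff vec.vector_space_axioms add scale)
  define P where "P = matrix p"
  have P: "P *v x = p x" for x
    unfolding P_def by (rule matrix_works[OF lin])
  have pS: "p x = x" if "x \<in> S" for x
    by (rule uniq) (use that in auto)
  have "P ** P = P"
    by (simp add: matrix_eq flip: matrix_vector_mul_assoc) (simp add: P pS p)
  moreover have "cadjoint P = P"
  proof -
    have "p x \<bullet> y = x \<bullet> p y" for x y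
      using p(2)[OF p(1)[of x], of y] p(2)[OF p(1)[of y], of x]
      by (simp add: inner_diff_left inner_diff_right inner_commute)
    then show ?thesis by (simp add: hermitian_iff_symmetric P)
  qed
  moreover have "matrix_range P = S"
    unfolding matrix_range_def P using p(1) pS by (auto simp: image_iff) (metis pS)
  ultimately show ?thesis by blast
qed

lemma idempotent_range_iff:
  assumes "P ** P = P"
  shows "x \<in> matrix_range P \<longleftrightarrow> P *v x = x"
  using assms by (auto simp: matrix_range_def image_iff matrix_vector_mul_assoc) metis

text \<open>Each projection fixes the range of the other, so \<open>P ** Q = Q\<close> and
  \<open>Q ** P = P\<close>; taking the adjoint of one identity and comparing gives
  \<open>P = Q\<close>.\<close>

lemma orth_proj_unique:
  assumes P: "P ** P = P" "cadjoint P = P" and Q: "Q ** Q = Q" "cadjoint Q = Q"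
    and eq: "matrix_range P = matrix_range Q"
  shows "P = Q"
proof -
  have *: "P *v (Q *v x) = Q *v x" "Q *v (P *v x) = P *v x" for x
    using idempotent_range_iff[OF P(1)] idempotent_range_iff[OF Q(1)] eq
    by (metis matrix_range_def rangeI)+
  then have "P ** Q = Q" "Q ** P = P"
    by (simp_all add: matrix_eq flip: matrix_vector_mul_assoc)
  then show ?thesis
    by (metis P(2) Q(2) cadjoint_mult)
qed

lemma orth_proj_props:
  assumes S: "vec.subspace (S :: (complex^'n) set)"
  shows "orth_proj S ** orth_proj S = orth_proj S" "cadjoint (orth_proj S) = orth_proj S"
    "matrix_range (orth_proj S) = S"
proof -
  have "\<exists>!P. P ** P = P \<and> cadjoint P = P \<and> matrix_range P = S"
    using orth_proj_exists[OF S] by (metis orth_proj_unique)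
  from theI'[OF this]
  show "orth_proj S ** orth_proj S = orth_proj S" "cadjoint (orth_proj S) = orth_proj S"
    "matrix_range (orth_proj S) = S"
    unfolding orth_proj_def by auto
qed

lemma orth_proj_fixes: "vec.subspace S \<Longrightarrow> x \<in> S \<Longrightarrow> orth_proj S *v x = x"
  by (simp add: idempotent_range_iff[symmetric] orth_proj_props)

lemma orth_proj_in: "vec.subspace S \<Longrightarrow> orth_proj S *v x \<in> S"
  by (metis matrix_range_def orth_proj_props(3) rangeI)

lemma orth_proj_symmetric:
  "vec.subspace S \<Longrightarrow> (orth_proj S *v x) \<bullet> y = x \<bullet> (orth_proj S *v y)"
  by (metis inner_cadjoint orth_proj_props(2))

lemma orth_proj_eq_0:
  assumes S: "vec.subspace S" and x: "\<And>w. w \<in> S \<Longrightarrow> x \<bullet> w = 0"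
  shows "orth_proj S *v x = 0"
proof -
  have "(orth_proj S *v x) \<bullet> (orth_proj S *v x) = x \<bullet> (orth_proj S *v (orth_proj S *v x))"
    by (rule orth_proj_symmetric[OF S])
  also have "\<dots> = 0" by (intro x orth_proj_in S)
  finally show ?thesis by simp
qed

section \<open>Functional calculus, spectral theorem and singular spaces\<close>

lemma subspace_eigenspace: "vec.subspace {v. T *v v = c *s (v::complex^'n)}"
  by (auto simp: vec.subspace_def matrix_vector_right_distrib vector_scalar_commute
      vector_add_ldistrib vector_smult_assoc mult.commute)

lemma hermitian_eigenvectors_orthogonal:
  assumes "cadjoint T = T" "T *v v = of_real s *s v" "T *v w = of_real t *s (w::complex^'n)" "s \<noteq> t"
  shows "v \<bullet> w = 0"
proof -
  have "s * (v \<bullet> w) = (T *v v) \<bullet> w"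
    using assms by (simp flip: scaleR_eq_of_real_smult)
  also have "\<dots> = v \<bullet> (T *v w)" using assms(1) by (metis inner_cadjoint)
  also have "\<dots> = t * (v \<bullet> w)"
    using assms by (simp flip: scaleR_eq_of_real_smult)
  finally show ?thesis using assms(4) by auto
qed

text \<open>Eigenvectors for distinct real eigenvalues are orthogonal, hence independent. Finiteness
  matters because the sum in \<open>func_calc\<close> would be 0 by default over an infinite index
  set.\<close>

lemma finite_real_eigenvalues:
  assumes T: "cadjoint T = (T::complex^'n^'n)"
  shows "finite {t. eigenvalue T (of_real t)}"
proof -
  let ?I = "{t. eigenvalue T (of_real t)}"
  obtain e where e: "\<And>t. t \<in> ?I \<Longrightarrow> e t \<noteq> 0 \<and> T *v e t = of_real t *s e t"
    unfolding eigenvalue_def eigenvector_def mem_Collect_eq mem_Collect_eq by atomize_elim (rule choice, blast)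
  have orth: "e s \<bullet> e t = 0" if "s \<in> ?I" "t \<in> ?I" "s \<noteq> t" for s t
    using hermitian_eigenvectors_orthogonal[OF T] e that by blast
  have inj: "inj_on e ?I"
    by (rule inj_onI) (metis e inner_eq_zero_iff orth)
  have "pairwise orthogonal (e ` ?I)"
    unfolding pairwise_def orthogonal_def using orth by blast
  moreover have "0 \<notin> e ` ?I" using e by auto
  ultimately have "independent (e ` ?I)" by (rule pairwise_orthogonal_independent)
  then have "finite (e ` ?I)" by (rule independent_imp_finite)
  then show ?thesis using inj by (rule finite_imageD)
qed

text \<open>By orthogonality of the eigenspaces only the projection onto the
  \<open>t\<close>-eigenspace survives. The case \<open>v = 0\<close> is included, so that
  components of a vector can be inserted without checking that they are non-zero.\<close>

lemma func_calc_eigenvector: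
  assumes T: "cadjoint T = T" and v: "T *v v = of_real t *s v"
  shows "func_calc f T *v v = f t *\<^sub>R v"
proof (cases "v = 0")
  case False
  let ?I = "{t. eigenvalue T (of_real t)}"
  let ?H = "\<lambda>s. orth_proj {v. T *v v = of_real s *s v}"
  have t: "t \<in> ?I" using False v by (auto simp: eigenvalue_def eigenvector_def)
  have zero: "?H s *v v = 0" if "s \<noteq> t" for s
    using that v by (intro orth_proj_eq_0 subspace_eigenspace)
      (auto intro: hermitian_eigenvectors_orthogonal[OF T])
  have one: "?H t *v v = v"
    using v by (intro orth_proj_fixes subspace_eigenspace) auto
  have "func_calc f T *v v = (\<Sum>s\<in>?I. f s *\<^sub>R (?H s *v v))"
    by (simp add: func_calc_def matrix_sum_mult_vec scaleR_matrix_mult_vec)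
  also have "\<dots> = (\<Sum>s\<in>?I. if s = t then f t *\<^sub>R v else 0)"
    by (rule sum.cong) (auto simp: zero one)
  also have "\<dots> = f t *\<^sub>R v"
    using t finite_real_eigenvalues[OF T] by simp
  finally show ?thesis .
qed auto

lemma cadjoint_func_calc: "cadjoint (func_calc f T) = func_calc f T"
  unfolding hermitian_iff_symmetric func_calc_def
  by (auto simp: matrix_sum_mult_vec scaleR_matrix_mult_vec inner_sum_left inner_sum_right
      orth_proj_symmetric[OF subspace_eigenspace])

text \<open>The orthogonal complement \<open>U\<close> of all eigenvectors is invariant under
  \<open>T\<close>; were it non-zero it would contain an eigenvector, which would be orthogonal to
  itself.\<close>

lemma hermitian_spectral_decomposition:
  fixes T :: "complex^'n^'n"
  assumes T: "cadjoint T = T"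
  defines "I \<equiv> {t. eigenvalue T (of_real t)}"
    and "H \<equiv> \<lambda>t. orth_proj {v. T *v v = of_real t *s v}"
  shows "(\<Sum>t\<in>I. H t *v x) = x"
proof -
  have sym: "(T *v x) \<bullet> y = x \<bullet> (T *v y)" for x y
    using T by (metis inner_cadjoint)
  define U where "U = {y. \<forall>s v. T *v v = of_real s *s v \<longrightarrow> y \<bullet> v = 0}"
  have "subspace U"
    unfolding subspace_def U_def by (auto simp: inner_add_left) (metis add.right_neutral)
  moreover have "(*v) T ` U \<subseteq> U"
  proof clarify
    fix x assume x: "x \<in> U"
    have "(T *v x) \<bullet> v = 0" if v: "T *v v = of_real s *s v" for s v
    proof -
      have "(T *v x) \<bullet> v = s * (x \<bullet> v)"
        by (simp add: sym v flip: scaleR_eq_of_real_smult)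
      also have "x \<bullet> v = 0" using x v by (auto simp: U_def)
      finally show ?thesis by simp
    qed
    then show "T *v x \<in> U" by (auto simp: U_def)
  qed
  ultimately have U0: "U = {0}"
  proof (rule_tac ccontr)
    assume U: "subspace U" "(*v) T ` U \<subseteq> U" "U \<noteq> {0}"
    obtain v t where "v \<in> U" "v \<noteq> 0" "T *v v = t *\<^sub>R v"
      by (rule symmetric_eigenvector_exists[OF _ _ U]) (auto simp: sym)
    then show False unfolding U_def scaleR_eq_of_real_smult by (metis (mono_tags, lifting) inner_eq_zero_iff mem_Collect_eq)
  qed
  have "x - (\<Sum>t\<in>I. H t *v x) \<in> U"
    unfolding U_def
  proof (intro CollectI allI impI)
    fix s v assume v: "T *v v = of_real s *s v"
    have "(\<Sum>t\<in>I. H t *v x) \<bullet> v = (\<Sum>t\<in>I. x \<bullet> (H t *v v))"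
      unfolding H_def by (simp add: inner_sum_left orth_proj_symmetric[OF subspace_eigenspace])
    \<comment> \<open>The sum of all eigenprojections is the functional calculus of the constant
      1.\<close>
    also have "\<dots> = x \<bullet> (func_calc (\<lambda>_. 1) T *v v)"
      by (simp add: inner_sum_right func_calc_def matrix_sum_mult_vec H_def I_def)
    also have "\<dots> = x \<bullet> v"
      by (simp add: func_calc_eigenvector[OF T v])
    finally show "(x - (\<Sum>t\<in>I. H t *v x)) \<bullet> v = 0"
      by (simp add: inner_diff_left)
  qed
  then show ?thesis using U0 by simp
qed

text \<open>The vectors \<open>y t\<close> are the components of \<open>x\<close> along the right singular spaces of \<open>X\<close>;
  the index \<open>t\<close> is the square of the singular value.\<close>

lemma singular_decomposition:
  fixes X :: "complex^'n^'n" and x :: "complex^'n"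
  obtains I y where "finite (I :: real set)" "(\<Sum>t\<in>I. y t) = x" "\<And>t. t \<in> I \<Longrightarrow> 0 \<le> t"
    "\<And>s t. s \<in> I \<Longrightarrow> t \<in> I \<Longrightarrow> s \<noteq> t \<Longrightarrow> y s \<bullet> y t = 0"
    "\<And>t. cadjoint X *v (X *v y t) = t *\<^sub>R y t"
    "\<And>t r. t \<in> I \<Longrightarrow> psd_powr (matrix_abs X) r *v y t = (sqrt t powr r) *\<^sub>R y t"
proof -
  define T where "T = cadjoint X ** X"
  define I where "I = {t. eigenvalue T (of_real t)}"
  define y where "y = (\<lambda>t. orth_proj {v. T *v v = of_real t *s v} *v x)"
  have T: "cadjoint T = T" by (simp add: T_def cadjoint_mult)
  have y: "T *v y t = of_real t *s y t" for t
    using orth_proj_in[OF subspace_eigenspace] unfolding y_def by blast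
  show thesis
  proof (rule that[of I y])
    show "finite I" unfolding I_def by (rule finite_real_eigenvalues[OF T])
    show "sum y I = x" unfolding I_def y_def by (rule hermitian_spectral_decomposition[OF T])
    show "y s \<bullet> y t = 0" if "s \<noteq> t" for s t
      using hermitian_eigenvectors_orthogonal[OF T y y that] .
    show "cadjoint X *v (X *v y t) = t *\<^sub>R y t" for t
      using y by (simp add: T_def matrix_vector_mul_assoc scaleR_eq_of_real_smult)
    show "0 \<le> t" if "t \<in> I" for t
    proof -
      from that obtain v where v: "v \<noteq> 0" "T *v v = of_real t *s v"
        unfolding I_def eigenvalue_def eigenvector_def by auto
      have "t * (v \<bullet> v) = (T *v v) \<bullet> v" by (simp add: v flip: scaleR_eq_of_real_smult)
      also have "\<dots> = (X *v v) \<bullet> (X *v v)"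
        by (simp add: T_def inner_cadjoint[of X] inner_commute flip: matrix_vector_mul_assoc)
      finally have "0 \<le> t * (v \<bullet> v)" by simp
      then show ?thesis
        using v(1) inner_gt_zero_iff[of v] by (metis not_le zero_le_mult_iff)
    qed
    show "psd_powr (matrix_abs X) r *v y t = (sqrt t powr r) *\<^sub>R y t" for t r
    proof -
      have "matrix_abs X *v y t = of_real (sqrt t) *s y t"
        using func_calc_eigenvector[OF T y, of sqrt]
        by (simp add: matrix_abs_def T_def scaleR_eq_of_real_smult)
      \<comment> \<open>A second use of the functional calculus, now for
        \<open>matrix_abs X\<close>, which is Hermitian itself.\<close>
      then show ?thesis
        unfolding psd_powr_def
        by (rule func_calc_eigenvector[rotated]) (simp add: matrix_abs_def cadjoint_func_calc)
    qed
  qed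
qed

section \<open>Criteria for convergence and positivity, and the deviation estimate\<close>

text \<open>The images of the standard basis vectors are the columns, so pointwise convergence gives
  entrywise convergence. The limit can thus be computed vector by vector.\<close>

lemma matrix_tendstoI:
  fixes B :: "nat \<Rightarrow> complex^'n^'m"
  assumes "\<And>x. (\<lambda>n. B n *v x) \<longlonglongrightarrow> M *v x"
  shows "B \<longlonglongrightarrow> M"
proof (rule vec_tendstoI, rule vec_tendstoI)
  fix i j
  have "(T *v axis j 1) $ i = T $ i $ j" for T :: "complex^'n^'m"
    by (simp add: matrix_vector_mult_def axis_def if_distrib[of "(*) _"] cong: if_cong)
  then show "(\<lambda>n. B n $ i $ j) \<longlonglongrightarrow> M $ i $ j"
    using tendsto_vec_nth[OF assms[of "axis j 1"], of i] by simp
qed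

text \<open>\<open>psd\<close> also asks the complex form to be real. Its imaginary part is the real
  inner product with \<open>\<i> *s x\<close>, which symmetry makes equal to its own
  negative.\<close>

lemma psd_if_hermitian:
  assumes sym: "\<And>x y. (M *v x) \<bullet> y = x \<bullet> (M *v y)" and nonneg: "\<And>x. 0 \<le> (M *v x) \<bullet> x"
  shows "psd M"
proof -
  have Re: "Re (cinner x y) = x \<bullet> y" for x y :: "complex^'n"
    by (simp add: cinner_def inner_vec_def inner_complex_def)
  have Im: "Im (cinner x y) = x \<bullet> (\<i> *s y)" for x y :: "complex^'n"
    by (simp add: cinner_def inner_vec_def inner_complex_def algebra_simps)
  have "(M *v x) \<bullet> (\<i> *s x) = 0" for x
  proof -
    have "(M *v x) \<bullet> (\<i> *s x) = x \<bullet> (\<i> *s (M *v x))"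
      by (simp add: sym vector_scalar_commute)
    also have "\<dots> = - ((\<i> *s x) \<bullet> (M *v x))"
      by (simp add: inner_vec_def inner_complex_def algebra_simps flip: sum_negf)
    finally show ?thesis by (simp add: inner_commute)
  qed
  then show ?thesis
    unfolding psd_def by (auto simp: Re Im nonneg complex_is_Real_iff)
qed

text \<open>Decompose \<open>x\<close> along the singular spaces of \<open>X\<close>, with singular values \<open>s\<^sup>n\<close>. Components with
  \<open>s > \<rho> + \<epsilon>\<close> are
  controlled by \<open>norm (X *v x)\<close>, those with \<open>s < \<rho> - \<epsilon>\<close> by the hypothesis on \<open>b\<close> applied to
  their sum.\<close>

lemma root_abs_deviation:
  fixes X :: "complex^'n^'n"
  assumes n: "n \<ge> 1" and \<epsilon>: "\<epsilon> > 0" and \<rho>: "\<rho> \<ge> 0" and b: "b \<ge> 0"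
    and low: "\<And>u. \<epsilon> < \<rho> \<Longrightarrow> u \<bullet> x \<le> b * norm (X *v u)"
  shows "(norm (psd_powr (matrix_abs X) (1 / real n) *v x - \<rho> *\<^sub>R x))\<^sup>2
    \<le> \<epsilon>\<^sup>2 * (norm x)\<^sup>2 + (\<rho> + \<epsilon>)\<^sup>2 * (norm (X *v x) / (\<rho> + \<epsilon>) ^ n)\<^sup>2
      + \<rho>\<^sup>2 * (b * (\<rho> - \<epsilon>) ^ n)\<^sup>2"
proof -
  obtain I y where I: "finite I" and x: "(\<Sum>t\<in>I. y t) = x" and t0: "\<And>t. t \<in> I \<Longrightarrow> 0 \<le> t"
    and orth: "\<And>s t. s \<in> I \<Longrightarrow> t \<in> I \<Longrightarrow> s \<noteq> t \<Longrightarrow> y s \<bullet> y t = 0"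
    and XX: "\<And>t. cadjoint X *v (X *v y t) = t *\<^sub>R y t"
    and B: "\<And>t r. t \<in> I \<Longrightarrow> psd_powr (matrix_abs X) r *v y t = (sqrt t powr r) *\<^sub>R y t"
    using singular_decomposition[of x X] by metis
  define s where "s = (\<lambda>t. sqrt t powr (1 / real n))"
  have s0: "s t \<ge> 0" for t by (simp add: s_def)
  have s_pow: "(s t ^ n)\<^sup>2 = t" if "t \<in> I" for t
  proof (cases "t = 0")
    case True
    \<comment> \<open>Here \<open>0 powr _\<close> is 0, and the power \<open>n\<close> is
      positive.\<close>
    then show ?thesis using n by (simp add: s_def)
  next
    case False
    then have "t > 0" using t0[OF that] by simp
    then have "s t ^ n = sqrt t"
      using n by (simp add: s_def powr_powr flip: powr_realpow)
    then show ?thesis using t0[OF that] by simp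
  qed
  have pyth: "(norm (\<Sum>t\<in>J. c t *\<^sub>R y t))\<^sup>2 = (\<Sum>t\<in>J. (c t)\<^sup>2 * (norm (y t))\<^sup>2)"
    if "J \<subseteq> I" for J c
  proof -
    have "(norm (\<Sum>t\<in>J. c t *\<^sub>R y t))\<^sup>2 = (\<Sum>t\<in>J. (norm (c t *\<^sub>R y t))\<^sup>2)"
      using that I orth
      by (intro norm_sum_Pythagorean) (auto simp: pairwise_def orthogonal_def finite_subset subset_iff)
    then show ?thesis by (simp add: power_mult_distrib)
  qed
  have Xinner: "(X *v y r) \<bullet> (X *v y t) = t * (y r \<bullet> y t)" for r t
    by (simp add: inner_cadjoint XX)
  have pythX: "(norm (X *v (\<Sum>t\<in>J. y t)))\<^sup>2 = (\<Sum>t\<in>J. t * (norm (y t))\<^sup>2)" if "J \<subseteq> I" for J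
  proof -
    have "X *v (\<Sum>t\<in>J. y t) = (\<Sum>t\<in>J. X *v y t)"
      by (rule linear_sum[OF matrix_vector_mul_linear])
    moreover have "(norm (\<Sum>t\<in>J. X *v y t))\<^sup>2 = (\<Sum>t\<in>J. (norm (X *v y t))\<^sup>2)"
      using that I orth
      by (intro norm_sum_Pythagorean)
        (auto simp: pairwise_def orthogonal_def finite_subset subset_iff Xinner)
    ultimately show ?thesis by (simp add: power2_norm_eq_inner Xinner)
  qed
  define J where "J = {t\<in>I. s t < \<rho> - \<epsilon>}"
  define u where "u = (\<Sum>t\<in>J. y t)"
  have JI: "J \<subseteq> I" by (auto simp: J_def)
  have u_sq: "(norm u)\<^sup>2 = (\<Sum>t\<in>J. (norm (y t))\<^sup>2)"
    using pyth[OF JI, of "\<lambda>_. 1"] by (simp add: u_def)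
  have u_bound: "(norm u)\<^sup>2 \<le> (b * (\<rho> - \<epsilon>) ^ n)\<^sup>2"
  proof (cases "\<epsilon> < \<rho>")
    case False
    \<comment> \<open>The numbers \<open>s t\<close> are nonnegative, so none lies below a threshold
      that is at most 0.\<close>
    then have "J = {}" using s0 by (auto simp: J_def not_less) (metis diff_gt_0_iff_gt not_less order_le_less_trans)
    then show ?thesis by (simp add: u_def)
  next
    case True
    have "(norm (X *v u))\<^sup>2 = (\<Sum>t\<in>J. t * (norm (y t))\<^sup>2)"
      unfolding u_def by (rule pythX[OF JI])
    also have "\<dots> \<le> (\<Sum>t\<in>J. ((\<rho> - \<epsilon>) ^ n)\<^sup>2 * (norm (y t))\<^sup>2)"
    proof (intro sum_mono mult_right_mono)
      fix t assume t: "t \<in> J"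
      have "t = (s t ^ n)\<^sup>2" using s_pow t JI by auto
      also have "\<dots> \<le> ((\<rho> - \<epsilon>) ^ n)\<^sup>2"
        using t s0 by (intro power_mono) (auto simp: J_def)
      finally show "t \<le> ((\<rho> - \<epsilon>) ^ n)\<^sup>2" .
    qed simp
    also have "\<dots> = ((\<rho> - \<epsilon>) ^ n * norm u)\<^sup>2"
      by (simp add: u_sq power_mult_distrib sum_distrib_left)
    finally have Xu: "norm (X *v u) \<le> (\<rho> - \<epsilon>) ^ n * norm u"
      using True by (simp add: power2_le_iff_abs_le)
    \<comment> \<open>By orthogonality \<open>u \<bullet> x\<close> is the squared norm of
      \<open>u\<close>, so \<open>low\<close> bounds \<open>norm u\<close> by \<open>b\<close> times
      the small expansion of \<open>u\<close> under \<open>X\<close>.\<close>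
    have "u \<bullet> x = (\<Sum>t\<in>J. (norm (y t))\<^sup>2)"
    proof -
      have "y t \<bullet> x = (norm (y t))\<^sup>2" if "t \<in> J" for t
      proof -
        have "y t \<bullet> x = (\<Sum>r\<in>I. y t \<bullet> y r)" by (simp add: inner_sum_right flip: x)
        also have "\<dots> = (\<Sum>r\<in>I. if r = t then (norm (y t))\<^sup>2 else 0)"
          using that JI orth by (intro sum.cong) (auto simp: power2_norm_eq_inner)
        finally show ?thesis using I that JI by auto
      qed
      then show ?thesis by (simp add: u_def inner_sum_left)
    qed
    then have "norm u * norm u \<le> b * norm (X *v u)"
      using low[OF True, of u] u_sq by (simp add: power2_eq_square)
    also have "\<dots> \<le> (b * (\<rho> - \<epsilon>) ^ n) * norm u"
      using Xu b by (simp add: mult_left_mono mult.assoc)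
    finally have "norm u \<le> b * (\<rho> - \<epsilon>) ^ n"
      using b True by (cases "u = 0") auto
    then show ?thesis by (intro power_mono) auto
  qed
  \<comment> \<open>Chosen so that \<open>q * t\<close> dominates the square of \<open>s t\<close>
    whenever \<open>s t\<close> exceeds \<open>\<rho> + \<epsilon>\<close>.\<close>
  define q where "q = (\<rho> + \<epsilon>)\<^sup>2 / ((\<rho> + \<epsilon>) ^ n)\<^sup>2"
  have q0: "q \<ge> 0" by (simp add: q_def)
  have term_bound: "(s t - \<rho>)\<^sup>2 \<le> \<epsilon>\<^sup>2 + q * t + (if t \<in> J then \<rho>\<^sup>2 else 0)" if t: "t \<in> I" for t
  proof -
    \<comment> \<open>Low components are paid for by the term with \<open>J\<close>, middle ones by
      the square of \<open>\<epsilon>\<close>, high ones by \<open>q * t\<close>.\<close>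
    consider "s t < \<rho> - \<epsilon>" | "\<rho> - \<epsilon> \<le> s t" "s t \<le> \<rho> + \<epsilon>" | "\<rho> + \<epsilon> < s t" by linarith
    then show ?thesis
    proof cases
      case 1
      then have "(\<rho> - s t)\<^sup>2 \<le> \<rho>\<^sup>2" using s0[of t] \<epsilon> by (intro power_mono) auto
      moreover have "t \<in> J" using 1 t by (simp add: J_def)
      moreover have "0 \<le> q * t" using q0 t0[OF t] by simp
      ultimately show ?thesis by (simp add: power2_commute[of "s t"] add_increasing)
    next
      case 2
      then have "(s t - \<rho>)\<^sup>2 \<le> \<epsilon>\<^sup>2" by (intro power2_le_iff_abs_le[THEN iffD2]) (use \<epsilon> in auto)
      moreover have "0 \<le> q * t" using q0 t0[OF t] by simp
      ultimately show ?thesis by (simp add: add_increasing2)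
    next
      case 3
      define w where "w = s t / (\<rho> + \<epsilon>)"
      have pos: "\<rho> + \<epsilon> > 0" using \<rho> \<epsilon> by simp
      have "w \<ge> 1" using 3 pos by (simp add: w_def)
      have "(s t - \<rho>)\<^sup>2 \<le> (s t)\<^sup>2" using 3 \<rho> \<epsilon> by (intro power_mono) auto
      also have "\<dots> = (\<rho> + \<epsilon>)\<^sup>2 * w\<^sup>2" using pos by (simp add: w_def power_divide)
      \<comment> \<open>The ratio \<open>w\<close> is at least 1, so raising it to the power
        \<open>n\<close> only increases it and brings in the singular value itself.\<close>
      also have "\<dots> \<le> (\<rho> + \<epsilon>)\<^sup>2 * (w ^ n)\<^sup>2"
        using \<open>w \<ge> 1\<close> n by (intro mult_left_mono power_mono self_le_power) auto
      also have "\<dots> = q * t"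
        by (simp add: q_def w_def power_divide s_pow[OF t])
      finally show ?thesis by (simp add: add_increasing add_increasing2)
    qed
  qed
  have "psd_powr (matrix_abs X) (1 / real n) *v x - \<rho> *\<^sub>R x = (\<Sum>t\<in>I. (s t - \<rho>) *\<^sub>R y t)"
  proof -
    have "psd_powr (matrix_abs X) (1 / real n) *v x = (\<Sum>t\<in>I. s t *\<^sub>R y t)"
      unfolding x[symmetric] linear_sum[OF matrix_vector_mul_linear]
      by (intro sum.cong) (simp_all add: B s_def)
    moreover have "\<rho> *\<^sub>R x = (\<Sum>t\<in>I. \<rho> *\<^sub>R y t)"
      by (simp add: scaleR_sum_right flip: x)
    ultimately show ?thesis by (simp add: sum_subtractf scaleR_left_diff_distrib)
  qed
  then have "(norm (psd_powr (matrix_abs X) (1 / real n) *v x - \<rho> *\<^sub>R x))\<^sup>2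
      = (\<Sum>t\<in>I. (s t - \<rho>)\<^sup>2 * (norm (y t))\<^sup>2)"
    by (simp add: pyth)
  also have "\<dots> \<le> (\<Sum>t\<in>I. (\<epsilon>\<^sup>2 + q * t + (if t \<in> J then \<rho>\<^sup>2 else 0)) * (norm (y t))\<^sup>2)"
    by (intro sum_mono mult_right_mono term_bound) auto
  also have "\<dots> = \<epsilon>\<^sup>2 * (\<Sum>t\<in>I. (norm (y t))\<^sup>2) + q * (\<Sum>t\<in>I. t * (norm (y t))\<^sup>2)
      + (\<Sum>t\<in>I. if t \<in> J then \<rho>\<^sup>2 * (norm (y t))\<^sup>2 else 0)"
    unfolding sum_distrib_left sum.distrib[symmetric] by (intro sum.cong) (auto simp: algebra_simps)
  also have "(\<Sum>t\<in>I. if t \<in> J then \<rho>\<^sup>2 * (norm (y t))\<^sup>2 else 0) = \<rho>\<^sup>2 * (norm u)\<^sup>2"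
    using I JI by (simp add: u_sq sum_distrib_left Int_absorb1 flip: sum.inter_restrict)
  also have "(\<Sum>t\<in>I. (norm (y t))\<^sup>2) = (norm x)\<^sup>2"
    using pyth[of I "\<lambda>_. 1"] by (simp add: x)
  also have "(\<Sum>t\<in>I. t * (norm (y t))\<^sup>2) = (norm (X *v x))\<^sup>2"
    using pythX[of I] by (simp add: x)
  also have "q * (norm (X *v x))\<^sup>2 = (\<rho> + \<epsilon>)\<^sup>2 * (norm (X *v x) / (\<rho> + \<epsilon>) ^ n)\<^sup>2"
    by (simp add: q_def power_divide)
  also have "\<rho>\<^sup>2 * (norm u)\<^sup>2 \<le> \<rho>\<^sup>2 * (b * (\<rho> - \<epsilon>) ^ n)\<^sup>2"
    using u_bound by (intro mult_left_mono) auto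
  finally show ?thesis by simp
qed

section \<open>Matrix powers and coordinates diagonalising \<open>D\<close>\<close>

lemma matpow_Suc_vec: "matpow A (Suc n) *v x = A *v (matpow A n *v x)"
  by (simp add: matrix_vector_mul_assoc)

lemma matpow_vec_commute:
  assumes "B ** A = A ** B"
  shows "matpow A n *v (B *v x) = B *v (matpow A n *v x)"
proof (induction n)
  case (Suc n)
  have "matpow A (Suc n) *v (B *v x) = A *v (B *v (matpow A n *v x))"
    by (simp add: Suc flip: matrix_vector_mul_assoc)
  also have "\<dots> = B *v (matpow A (Suc n) *v x)"
    using assms by (simp add: matrix_vector_mul_assoc matrix_mul_assoc)
  finally show ?case .
qed simp

lemma matrix_vec_norm_bound:
  fixes T :: "complex^'n^'m"
  obtains K where "K > 0" "\<And>x. norm (T *v x) \<le> K * norm x"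
  using linear_bounded_pos[of "(*v) T"] by auto

locale jordan_coords =
  fixes A D N P L :: "complex^'n^'n" and r :: nat
  assumes A_eq: "A = D + N" and DN: "D ** N = N ** D" and invP: "invertible P"
    and diag: "\<And>i j. i \<noteq> j \<Longrightarrow> L $ i $ j = 0" and D_eq: "D = P ** L ** matrix_inv P"
    and nil: "matpow N r = 0"
begin

definition lam :: "'n \<Rightarrow> complex" where "lam i = L $ i $ i"

text \<open>Coordinates in the eigenbasis of \<open>D\<close> formed by the columns of
  \<open>P\<close>; column \<open>i\<close> belongs to the eigenvalue \<open>lam i\<close>.\<close>

definition crd :: "complex^'n \<Rightarrow> complex^'n" where "crd x = matrix_inv P *v x"

text \<open>The sum of the eigenspaces of \<open>D\<close> whose eigenvalue satisfies
  \<open>S\<close>, encoded by vanishing coordinates.\<close>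

definition spec_space :: "(complex \<Rightarrow> bool) \<Rightarrow> (complex^'n) set" where
  "spec_space S = {x. \<forall>i. \<not> S (lam i) \<longrightarrow> crd x $ i = 0}"

text \<open>The spectral projection onto \<open>spec_space S\<close> along the complementary
  spectral subspace; in general it is oblique, unlike \<open>orth_proj\<close>.\<close>

definition cut :: "(complex \<Rightarrow> bool) \<Rightarrow> complex^'n \<Rightarrow> complex^'n" where
  "cut S x = P *v (\<chi> i. if S (lam i) then crd x $ i else 0)"

lemma P_inv: "P ** matrix_inv P = mat 1" "matrix_inv P ** P = mat 1"
  using someI_ex[OF invP[unfolded invertible_def]] by (simp_all add: matrix_inv_def)

lemma P_crd [simp]: "P *v crd x = x"
  by (simp add: crd_def matrix_vector_mul_assoc P_inv)

lemma crd_P [simp]: "crd (P *v x) = x"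
  by (simp add: crd_def matrix_vector_mul_assoc P_inv)

lemma crd_inject: "crd x = crd y \<longleftrightarrow> x = y"
  by (metis P_crd)

lemma crd_simps:
  "crd (x + y) = crd x + crd y" "crd (x - y) = crd x - crd y" "crd (c *s x) = c *s crd x"
  "crd (k *\<^sub>R x) = k *\<^sub>R crd x" "crd 0 = 0"
  by (simp_all add: crd_def matrix_vector_right_distrib matrix_vector_mult_diff_distrib
      vector_scalar_commute scaleR_eq_of_real_smult)

lemma crd_D: "crd (D *v x) $ i = lam i * crd x $ i"
proof -
  have "crd (D *v x) = L *v crd x"
    by (simp add: D_eq flip: matrix_vector_mul_assoc) (simp add: crd_def)
  then have "crd (D *v x) $ i = (\<Sum>j\<in>UNIV. L $ i $ j * crd x $ j)"
    by (simp add: matrix_vector_mult_def)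
  also have "\<dots> = (\<Sum>j\<in>UNIV. if j = i then lam i * crd x $ i else 0)"
    by (rule sum.cong) (auto simp: lam_def diag)
  finally show ?thesis by simp
qed

lemma spec_space_subspace: "vec.subspace (spec_space S)"
  by (auto simp: vec.subspace_def spec_space_def crd_simps)

lemma spec_space_D: "x \<in> spec_space S \<Longrightarrow> D *v x \<in> spec_space S"
  by (auto simp: spec_space_def crd_D)

text \<open>In the coordinates \<open>crd\<close>, the matrix of \<open>N\<close> has no entry between distinct eigenvalues of
  \<open>D\<close> because it commutes with the diagonal matrix \<open>L\<close>.\<close>

lemma spec_space_N:
  assumes x: "x \<in> spec_space S"
  shows "N *v x \<in> spec_space S"
proof -
  define M where "M = matrix_inv P ** N ** P"
  have crdN: "crd (N *v x) = M *v crd x" for x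
    by (simp add: M_def flip: matrix_vector_mul_assoc) (simp add: crd_def)
  have M0: "M $ i $ j = 0" if "lam i \<noteq> lam j" for i j
  proof -
    let ?e = "P *v axis j 1"
    have eD: "D *v ?e = lam j *s ?e"
    proof -
      have "crd (D *v ?e) = crd (lam j *s ?e)"
        by (simp add: vec_eq_iff crd_D) (simp add: crd_simps axis_def)
      then show ?thesis by (simp add: crd_inject)
    qed
    have col: "M $ i $ j = crd (N *v ?e) $ i"
      by (simp only: crdN crd_P) (simp add: matrix_vector_mult_def axis_def if_distrib[of "(*) _"] cong: if_cong)
    have "lam i * M $ i $ j = crd (D *v (N *v ?e)) $ i"
      by (simp add: crd_D col)
    also have "D *v (N *v ?e) = N *v (D *v ?e)"
      by (metis matrix_vector_mul_assoc DN)
    also have "crd \<dots> $ i = lam j * M $ i $ j"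
      by (simp add: eD vector_scalar_commute crd_simps col)
    finally show ?thesis using that by simp
  qed
  show ?thesis
    unfolding spec_space_def
  proof (intro CollectI allI impI)
    fix i assume i: "\<not> S (lam i)"
    have "(\<Sum>j\<in>UNIV. M $ i $ j * crd x $ j) = 0"
    proof (rule sum.neutral, rule ballI)
      fix j
      show "M $ i $ j * crd x $ j = 0"
        using M0[of i j] x i by (cases "lam i = lam j") (auto simp: spec_space_def)
    qed
    then show "crd (N *v x) $ i = 0"
      unfolding crdN by (simp add: matrix_vector_mult_def)
  qed
qed

lemma spec_space_A: "x \<in> spec_space S \<Longrightarrow> A *v x \<in> spec_space S"
  by (simp add: A_eq matrix_vector_mult_add_rdistrib spec_space_D spec_space_N
      spec_space_subspace vec.subspace_add)

lemma spec_space_matpow_A: "x \<in> spec_space S \<Longrightarrow> matpow A n *v x \<in> spec_space S"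
  by (induction n) (simp_all add: spec_space_A flip: matrix_vector_mul_assoc)

lemma spec_space_matpow_N: "x \<in> spec_space S \<Longrightarrow> matpow N n *v x \<in> spec_space S"
  by (induction n) (simp_all add: spec_space_N flip: matrix_vector_mul_assoc)

lemma crd_cut: "crd (cut S x) $ i = (if S (lam i) then crd x $ i else 0)"
  by (simp add: cut_def)

lemma cut_in: "cut S x \<in> spec_space S"
  by (simp add: spec_space_def crd_cut)

lemma diff_cut_in: "x - cut S x \<in> spec_space (\<lambda>z. \<not> S z)"
  by (simp add: spec_space_def crd_cut crd_simps)

lemma cut_eq_0_iff: "cut S x = 0 \<longleftrightarrow> x \<in> spec_space (\<lambda>z. \<not> S z)"
proof -
  have "cut S x = 0 \<longleftrightarrow> crd (cut S x) = 0"
    using crd_inject[of "cut S x" 0] by (simp only: crd_simps)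
  also have "\<dots> \<longleftrightarrow> x \<in> spec_space (\<lambda>z. \<not> S z)"
    unfolding vec_eq_iff crd_cut spec_space_def by auto
  finally show ?thesis .
qed

lemma cut_fixes: "x \<in> spec_space S \<Longrightarrow> cut S x = x"
  by (rule crd_inject[THEN iffD1]) (auto simp: spec_space_def crd_cut vec_eq_iff)

lemma cut_add: "cut S (x + y) = cut S x + cut S y"
  by (rule crd_inject[THEN iffD1]) (auto simp: crd_cut vec_eq_iff crd_simps)

text \<open>Both complementary spectral subspaces are invariant under \<open>A\<close>, so the
  projection commutes with its powers.\<close>

lemma cut_matpow_A: "cut S (matpow A n *v x) = matpow A n *v cut S x"
proof -
  have "cut S (matpow A n *v x) = cut S (matpow A n *v cut S x + matpow A n *v (x - cut S x))"
    by (simp flip: matrix_vector_right_distrib)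
  also have "\<dots> = cut S (matpow A n *v cut S x) + cut S (matpow A n *v (x - cut S x))"
    by (rule cut_add)
  also have "cut S (matpow A n *v cut S x) = matpow A n *v cut S x"
    by (intro cut_fixes spec_space_matpow_A cut_in)
  also have "cut S (matpow A n *v (x - cut S x)) = 0"
    unfolding cut_eq_0_iff by (intro spec_space_matpow_A diff_cut_in)
  finally show ?thesis by simp
qed

lemma cut_bound:
  obtains K where "K > 0" "\<And>x. norm (cut S x) \<le> K * norm x"
proof -
  obtain K1 where K1: "K1 > 0" "\<And>x. norm (P *v x) \<le> K1 * norm x"
    using matrix_vec_norm_bound by blast
  obtain K2 where K2: "K2 > 0" "\<And>x. norm (crd x) \<le> K2 * norm x"
    unfolding crd_def using matrix_vec_norm_bound by blast
  have "norm (cut S x) \<le> (K1 * K2) * norm x" for x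
  proof -
    have "norm (cut S x) \<le> K1 * norm (crd (cut S x))"
      using K1(2)[of "crd (cut S x)"] by simp
    also have "norm (crd (cut S x)) \<le> norm (crd x)"
      by (rule norm_le_componentwise_cart) (simp add: crd_cut)
    also have "norm (crd x) \<le> K2 * norm x" by (rule K2)
    finally show ?thesis using K1(1) by (simp add: mult_left_mono mult.assoc)
  qed
  then show ?thesis using K1(1) K2(1) that[of "K1 * K2"] by simp
qed

section \<open>Norm estimates for \<open>D\<close> and the adapted norm\<close>

lemma norm_crd_D_le:
  assumes x: "x \<in> spec_space S" and S: "\<And>z. S z \<Longrightarrow> cmod z \<le> \<rho>" and "0 \<le> \<rho>"
  shows "norm (crd (D *v x)) \<le> \<rho> * norm (crd x)"
proof -
  have "norm (crd (D *v x)) \<le> norm (\<rho> *\<^sub>R crd x)"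
  proof (rule norm_le_componentwise_cart)
    fix i
    show "norm (crd (D *v x) $ i) \<le> norm ((\<rho> *\<^sub>R crd x) $ i)"
      using x S[of "lam i"] \<open>0 \<le> \<rho>\<close>
      by (cases "S (lam i)") (auto simp: crd_D norm_mult spec_space_def intro: mult_right_mono)
  qed
  then show ?thesis using \<open>0 \<le> \<rho>\<close> by simp
qed

lemma norm_crd_D_ge:
  assumes x: "x \<in> spec_space S" and S: "\<And>z. S z \<Longrightarrow> \<rho> \<le> cmod z" and "0 \<le> \<rho>"
  shows "\<rho> * norm (crd x) \<le> norm (crd (D *v x))"
proof -
  have "norm (\<rho> *\<^sub>R crd x) \<le> norm (crd (D *v x))"
  proof (rule norm_le_componentwise_cart)
    fix i
    show "norm ((\<rho> *\<^sub>R crd x) $ i) \<le> norm (crd (D *v x) $ i)"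
      using x S[of "lam i"] \<open>0 \<le> \<rho>\<close>
      by (cases "S (lam i)") (auto simp: crd_D norm_mult spec_space_def intro: mult_right_mono)
  qed
  then show ?thesis using \<open>0 \<le> \<rho>\<close> by simp
qed

text \<open>A norm adapted to the decomposition: \<open>N\<close> has norm at most \<open>\<epsilon>\<close>, while \<open>D\<close> still acts
  on it like a diagonal matrix.\<close>

definition adapted :: "real \<Rightarrow> complex^'n \<Rightarrow> real" where
  "adapted \<epsilon> x = (\<Sum>i<r. norm (crd (matpow N i *v x)) / \<epsilon> ^ i)"

text \<open>Applying \<open>N\<close> shifts the index of the sum by one, which costs a factor
  \<open>\<epsilon>\<close>; the term pushed past the end vanishes because
  \<open>matpow N r = 0\<close>.\<close>

lemma adapted_N:
  assumes "0 < \<epsilon>"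
  shows "adapted \<epsilon> (N *v x) \<le> \<epsilon> * adapted \<epsilon> x"
proof -
  let ?g = "\<lambda>i. norm (crd (matpow N i *v x)) / \<epsilon> ^ i"
  have "adapted \<epsilon> (N *v x) = (\<Sum>i<r. \<epsilon> * ?g (Suc i))"
    unfolding adapted_def using assms
    by (intro sum.cong) (simp_all add: matpow_vec_commute matpow_Suc_vec del: matpow.simps)
  also have "\<dots> = \<epsilon> * (\<Sum>i<r. ?g (Suc i))"
    by (simp add: sum_distrib_left)
  also have "(\<Sum>i<r. ?g (Suc i)) \<le> (\<Sum>i<Suc r. ?g i)"
    by (simp only: sum.lessThan_Suc_shift) simp
  also have "\<dots> = adapted \<epsilon> x"
    by (simp add: adapted_def nil crd_simps)
  finally show ?thesis using assms by simp
qed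

lemma adapted_triangle:
  assumes "0 < \<epsilon>"
  shows "adapted \<epsilon> (x + y) \<le> adapted \<epsilon> x + adapted \<epsilon> y"
    and "adapted \<epsilon> x - adapted \<epsilon> y \<le> adapted \<epsilon> (x + y)"
proof -
  show tri: "adapted \<epsilon> (x + y) \<le> adapted \<epsilon> x + adapted \<epsilon> y" for x y
    unfolding adapted_def sum.distrib[symmetric] add_divide_distrib[symmetric]
    by (intro sum_mono divide_right_mono)
      (use assms in \<open>simp_all add: matrix_vector_right_distrib crd_simps norm_triangle_ineq\<close>)
  have "adapted \<epsilon> (- y) = adapted \<epsilon> y"
  proof -
    have "crd (matpow N i *v (- y)) = - crd (matpow N i *v y)" for i
      using crd_simps(3)[of "-1" "matpow N i *v y"] vector_scalar_commute[of "matpow N i" "-1" y]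
      by simp
    then show ?thesis by (simp add: adapted_def)
  qed
  then show "adapted \<epsilon> x - adapted \<epsilon> y \<le> adapted \<epsilon> (x + y)"
    using tri[of "x + y" "- y"] by simp
qed

text \<open>\<open>D\<close> commutes with the powers of \<open>N\<close>, so the estimate for a
  diagonal matrix applies to each summand.\<close>

lemma adapted_D_le:
  assumes "x \<in> spec_space S" "\<And>z. S z \<Longrightarrow> cmod z \<le> \<rho>" "0 \<le> \<rho>" "0 < \<epsilon>"
  shows "adapted \<epsilon> (D *v x) \<le> \<rho> * adapted \<epsilon> x"
  unfolding adapted_def sum_distrib_left
proof (rule sum_mono)
  fix i
  have "norm (crd (D *v (matpow N i *v x))) \<le> \<rho> * norm (crd (matpow N i *v x))"
    using assms by (intro norm_crd_D_le spec_space_matpow_N)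
  then show "norm (crd (matpow N i *v (D *v x))) / \<epsilon> ^ i
      \<le> \<rho> * (norm (crd (matpow N i *v x)) / \<epsilon> ^ i)"
    using assms by (simp add: matpow_vec_commute[OF DN] divide_right_mono)
qed

lemma adapted_D_ge:
  assumes "x \<in> spec_space S" "\<And>z. S z \<Longrightarrow> \<rho> \<le> cmod z" "0 \<le> \<rho>" "0 < \<epsilon>"
  shows "\<rho> * adapted \<epsilon> x \<le> adapted \<epsilon> (D *v x)"
  unfolding adapted_def sum_distrib_left
proof (rule sum_mono)
  fix i
  have "\<rho> * norm (crd (matpow N i *v x)) \<le> norm (crd (D *v (matpow N i *v x)))"
    using assms by (intro norm_crd_D_ge spec_space_matpow_N)
  then show "\<rho> * (norm (crd (matpow N i *v x)) / \<epsilon> ^ i)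
      \<le> norm (crd (matpow N i *v (D *v x))) / \<epsilon> ^ i"
    using assms by (simp add: matpow_vec_commute[OF DN] divide_right_mono)
qed

lemma adapted_matpow_le:
  assumes x: "x \<in> spec_space S" and S: "\<And>z. S z \<Longrightarrow> cmod z \<le> \<rho>" and "0 \<le> \<rho>" "0 < \<epsilon>"
  shows "adapted \<epsilon> (matpow A n *v x) \<le> (\<rho> + \<epsilon>) ^ n * adapted \<epsilon> x"
proof (induction n)
  case (Suc n)
  let ?y = "matpow A n *v x"
  have "adapted \<epsilon> (matpow A (Suc n) *v x) = adapted \<epsilon> (D *v ?y + N *v ?y)"
    unfolding matpow_Suc_vec A_eq matrix_vector_mult_add_rdistrib ..
  also have "\<dots> \<le> adapted \<epsilon> (D *v ?y) + adapted \<epsilon> (N *v ?y)"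
    using assms by (intro adapted_triangle)
  also have "adapted \<epsilon> (D *v ?y) \<le> \<rho> * adapted \<epsilon> ?y"
    using assms by (intro adapted_D_le spec_space_matpow_A)
  also have "adapted \<epsilon> (N *v ?y) \<le> \<epsilon> * adapted \<epsilon> ?y"
    using assms by (intro adapted_N)
  also have "\<rho> * adapted \<epsilon> ?y + \<epsilon> * adapted \<epsilon> ?y = (\<rho> + \<epsilon>) * adapted \<epsilon> ?y"
    by (simp add: algebra_simps)
  also have "\<dots> \<le> (\<rho> + \<epsilon>) * ((\<rho> + \<epsilon>) ^ n * adapted \<epsilon> x)"
    using assms Suc by (intro mult_left_mono) auto
  finally show ?case by (simp add: mult.assoc)
qed simp

text \<open>Each step multiplies by at least \<open>\<rho>\<close> through \<open>D\<close> and
  loses at most \<open>\<epsilon>\<close> through \<open>N\<close>. The assumption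
  \<open>\<epsilon> \<le> \<rho>\<close> keeps the factor nonnegative for the induction.\<close>

lemma adapted_matpow_ge:
  assumes x: "x \<in> spec_space S" and S: "\<And>z. S z \<Longrightarrow> \<rho> \<le> cmod z" and "0 < \<epsilon>" "\<epsilon> \<le> \<rho>"
  shows "(\<rho> - \<epsilon>) ^ n * adapted \<epsilon> x \<le> adapted \<epsilon> (matpow A n *v x)"
proof (induction n)
  case (Suc n)
  let ?y = "matpow A n *v x"
  have "(\<rho> - \<epsilon>) ^ Suc n * adapted \<epsilon> x \<le> (\<rho> - \<epsilon>) * adapted \<epsilon> ?y"
    using assms Suc by (simp add: mult.assoc mult_left_mono)
  also have "\<dots> = \<rho> * adapted \<epsilon> ?y - \<epsilon> * adapted \<epsilon> ?y"
    by (simp add: algebra_simps)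
  also have "\<dots> \<le> adapted \<epsilon> (D *v ?y) - adapted \<epsilon> (N *v ?y)"
    using assms by (intro diff_mono adapted_N adapted_D_ge[of _ S] spec_space_matpow_A) auto
  also have "\<dots> \<le> adapted \<epsilon> (D *v ?y + N *v ?y)"
    using assms by (intro adapted_triangle)
  also have "\<dots> = adapted \<epsilon> (matpow A (Suc n) *v x)"
    unfolding matpow_Suc_vec A_eq matrix_vector_mult_add_rdistrib ..
  finally show ?case .
qed simp

text \<open>The summand with index 0 is the norm of the coordinates, which bounds
  \<open>norm x\<close>; conversely every summand is bounded by a multiple of
  \<open>norm x\<close>.\<close>

lemma adapted_equivalent:
  assumes "0 < \<epsilon>"
  obtains c C where "c > 0" "C > 0" "\<And>x. norm x \<le> c * adapted \<epsilon> x" "\<And>x. adapted \<epsilon> x \<le> C * norm x"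
proof -
  obtain c where c: "c > 0" "\<And>x. norm (P *v x) \<le> c * norm x"
    using matrix_vec_norm_bound by blast
  \<comment> \<open>Needed for the summand with index 0 to occur; the zeroth power of
    \<open>N\<close> is the identity, which is not 0.\<close>
  have "r \<noteq> 0"
  proof
    assume "r = 0"
    then have "(mat 1 :: complex^'n^'n) = 0" using nil by simp
    then show False by (metis matrix_vector_mul_lid matrix_vector_mult_0 axis_eq_0_iff zero_neq_one)
  qed
  have "norm x \<le> c * adapted \<epsilon> x" for x
  proof -
    have "norm (crd x) = (\<Sum>i\<in>{0}. norm (crd (matpow N i *v x)) / \<epsilon> ^ i)" by simp
    also have "\<dots> \<le> adapted \<epsilon> x"
      unfolding adapted_def using \<open>r \<noteq> 0\<close> assms by (intro sum_mono2) auto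
    finally show ?thesis
      using c(2)[of "crd x"] c(1) by (smt (verit) P_crd mult_left_mono)
  qed
  moreover have "\<exists>K. \<forall>x. norm (crd (matpow N i *v x)) / \<epsilon> ^ i \<le> K * norm x" for i
  proof -
    obtain K where "\<And>x. norm ((matrix_inv P ** matpow N i) *v x) \<le> K * norm x"
      using matrix_vec_norm_bound by blast
    then have "norm (crd (matpow N i *v x)) / \<epsilon> ^ i \<le> (K / \<epsilon> ^ i) * norm x" for x
      using assms by (simp add: crd_def matrix_vector_mul_assoc divide_right_mono)
    then show ?thesis by blast
  qed
  then obtain K where K: "\<And>i x. norm (crd (matpow N i *v x)) / \<epsilon> ^ i \<le> K i * norm x"
    by metis
  \<comment> \<open>The absolute value and the added 1 make the constant positive.\<close>
  have "adapted \<epsilon> x \<le> (\<bar>\<Sum>i<r. K i\<bar> + 1) * norm x" for x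
  proof -
    have "adapted \<epsilon> x \<le> (\<Sum>i<r. K i) * norm x"
      unfolding adapted_def sum_distrib_right by (intro sum_mono K)
    also have "\<dots> \<le> (\<bar>\<Sum>i<r. K i\<bar> + 1) * norm x"
      by (intro mult_right_mono) auto
    finally show ?thesis .
  qed
  ultimately show ?thesis using c(1) that[of c "\<bar>\<Sum>i<r. K i\<bar> + 1"] by auto
qed

section \<open>Growth rates on spectral subspaces\<close>

text \<open>The adapted norm with \<open>\<epsilon>\<close> equal to the gap between the two rates
  gives the bound; returning to the Euclidean norm costs a constant independent of
  \<open>n\<close>.\<close>

lemma growth_upper:
  assumes S: "\<And>z. S z \<Longrightarrow> cmod z \<le> \<rho>" and "0 \<le> \<rho>" "\<rho> < \<rho>'"
  obtains C where "C > 0" "\<And>n x. x \<in> spec_space S \<Longrightarrow> norm (matpow A n *v x) \<le> C * \<rho>' ^ n * norm x"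
proof -
  define \<epsilon> where "\<epsilon> = \<rho>' - \<rho>"
  have \<epsilon>: "0 < \<epsilon>" using assms by (simp add: \<epsilon>_def)
  obtain c C where cC: "c > 0" "C > 0" "\<And>x. norm x \<le> c * adapted \<epsilon> x" "\<And>x. adapted \<epsilon> x \<le> C * norm x"
    using adapted_equivalent[OF \<epsilon>] by blast
  have "norm (matpow A n *v x) \<le> (c * C) * \<rho>' ^ n * norm x" if x: "x \<in> spec_space S" for n x
  proof -
    have "norm (matpow A n *v x) \<le> c * adapted \<epsilon> (matpow A n *v x)" by (rule cC)
    also have "\<dots> \<le> c * (\<rho>' ^ n * adapted \<epsilon> x)"
      using adapted_matpow_le[OF x S _ \<epsilon>, where n = n] assms cC by (simp add: \<epsilon>_def)
    also have "\<dots> \<le> c * (\<rho>' ^ n * (C * norm x))"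
      using cC assms by (intro mult_left_mono) auto
    finally show ?thesis by (simp add: mult_ac)
  qed
  then show ?thesis using cC that[of "c * C"] by simp
qed

lemma growth_lower:
  assumes S: "\<And>z. S z \<Longrightarrow> \<rho> \<le> cmod z" and "0 \<le> \<rho>'" "\<rho>' < \<rho>"
  obtains C where "C > 0" "\<And>n x. x \<in> spec_space S \<Longrightarrow> \<rho>' ^ n * norm x \<le> C * norm (matpow A n *v x)"
proof -
  define \<epsilon> where "\<epsilon> = \<rho> - \<rho>'"
  have \<epsilon>: "0 < \<epsilon>" using assms by (simp add: \<epsilon>_def)
  obtain c C where cC: "c > 0" "C > 0" "\<And>x. norm x \<le> c * adapted \<epsilon> x" "\<And>x. adapted \<epsilon> x \<le> C * norm x"
    using adapted_equivalent[OF \<epsilon>] by blast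
  have "\<rho>' ^ n * norm x \<le> (c * C) * norm (matpow A n *v x)" if x: "x \<in> spec_space S" for n x
  proof -
    have "\<rho>' ^ n * norm x \<le> \<rho>' ^ n * (c * adapted \<epsilon> x)"
      using cC assms by (intro mult_left_mono) auto
    also have "\<dots> \<le> c * adapted \<epsilon> (matpow A n *v x)"
      using adapted_matpow_ge[OF x S \<epsilon>, where n = n] assms cC by (simp add: \<epsilon>_def)
    also have "\<dots> \<le> c * (C * norm (matpow A n *v x))"
      using cC by (intro mult_left_mono) auto
    finally show ?thesis by (simp add: mult_ac)
  qed
  then show ?thesis using cC that[of "c * C"] by simp
qed

section \<open>Eigenvalues of \<open>A\<close> and spans of eigenvectors of \<open>D\<close>\<close>

text \<open>The last non-zero vector \<open>w\<close> in the chain \<open>e\<close>,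
  \<open>N *v e\<close>, ... is killed by \<open>N\<close> and is still an eigenvector of
  \<open>D\<close>, so \<open>A\<close> acts on it as \<open>D\<close> does. This ties the moduli of
  the diagonal entries to those of the eigenvalues of \<open>A\<close>.\<close>

lemma eigenvalue_A_lam: "eigenvalue A (lam i)"
proof -
  define e where "e = P *v axis i 1"
  have e0: "e \<noteq> 0" unfolding e_def by (metis crd_P crd_simps(5) axis_eq_0_iff zero_neq_one)
  have De: "D *v e = lam i *s e"
  proof -
    have "crd (D *v e) = crd (lam i *s e)"
      by (simp add: vec_eq_iff crd_D) (simp add: crd_simps e_def axis_def)
    then show ?thesis by (simp add: crd_inject)
  qed
  define p where "p = (LEAST p. matpow N p *v e = 0)"
  have "matpow N r *v e = 0" by (simp add: nil)
  then have p0: "matpow N p *v e = 0" unfolding p_def by (rule LeastI)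
  then obtain q where q: "p = Suc q" using e0 by (cases p) auto
  define w where "w = matpow N q *v e"
  have "w \<noteq> 0" unfolding w_def using not_less_Least[of q "\<lambda>p. matpow N p *v e = 0"] q p_def by simp
  moreover have "N *v w = 0" using p0 by (simp add: q w_def matpow_Suc_vec del: matpow.simps)
  moreover have "D *v w = lam i *s w"
    unfolding w_def by (simp add: De vector_scalar_commute flip: matpow_vec_commute[OF DN])
  ultimately show ?thesis
    unfolding eigenvalue_def eigenvector_def
    by (intro exI[of _ w]) (simp add: A_eq matrix_vector_mult_add_rdistrib)
qed

text \<open>An eigenvector for \<open>l\<close> has non-zero coordinates only where
  \<open>lam i = l\<close>; conversely the columns of \<open>P\<close> are eigenvectors.\<close>

lemma span_eigenvectors_D:
  "vec.span {v. \<exists>l. eigenvector D v l \<and> S l} = spec_space S"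
proof
  show "vec.span {v. \<exists>l. eigenvector D v l \<and> S l} \<subseteq> spec_space S"
  proof (rule vec.span_minimal[OF _ spec_space_subspace], clarify)
    fix v l assume "eigenvector D v l" "S l"
    then have "lam i * crd v $ i = l * crd v $ i" for i
      by (metis crd_D crd_simps(3) eigenvector_def vector_smult_component)
    then show "v \<in> spec_space S"
      using \<open>S l\<close> by (auto simp: spec_space_def)
  qed
  show "spec_space S \<subseteq> vec.span {v. \<exists>l. eigenvector D v l \<and> S l}"
  proof
    fix x assume x: "x \<in> spec_space S"
    let ?e = "\<lambda>i. P *v axis i 1"
    have "x = P *v (\<Sum>i\<in>UNIV. crd x $ i *s axis i 1)"
      by (simp only: basis_expansion P_crd)
    also have "\<dots> = (\<Sum>i\<in>UNIV. crd x $ i *s ?e i)"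
      by (simp add: linear_sum[OF matrix_vector_mul_linear] vector_scalar_commute)
    also have "\<dots> \<in> vec.span {v. \<exists>l. eigenvector D v l \<and> S l}"
    proof (rule vec.span_sum)
      fix i
      show "crd x $ i *s ?e i \<in> vec.span {v. \<exists>l. eigenvector D v l \<and> S l}"
      proof (cases "S (lam i)")
        case True
        have "?e i \<noteq> 0" by (metis crd_P crd_simps(5) axis_eq_0_iff zero_neq_one)
        moreover have "crd (D *v ?e i) = crd (lam i *s ?e i)"
          by (simp add: vec_eq_iff crd_D) (simp add: crd_simps axis_def)
        ultimately show ?thesis
          using True by (intro vec.span_scale vec.span_base) (auto simp: crd_inject eigenvector_def)
      next
        case False
        then show ?thesis using x by (simp add: spec_space_def vec.span_zero)
      qed
    qed
    finally show "x \<in> vec.span {v. \<exists>l. eigenvector D v l \<and> S l}" .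
  qed
qed

lemma spec_space_empty:
  assumes "\<And>i. \<not> S (lam i)"
  shows "spec_space S = {0}"
proof -
  have "spec_space S = {x. crd x = crd 0}"
    using assms by (simp add: spec_space_def vec_eq_iff crd_simps)
  then show ?thesis by (simp add: crd_inject)
qed

lemma spec_space_cong:
  "(\<And>i. S (lam i) \<longleftrightarrow> S' (lam i)) \<Longrightarrow> spec_space S = spec_space S'"
  by (simp add: spec_space_def)

section \<open>Limits on the layers of the filtration by modulus\<close>

text \<open>The projection is bounded and commutes with powers of \<open>A\<close>, so the lower
  growth bound extends to arbitrary vectors through their component of large modulus.\<close>

lemma cut_growth_lower:
  assumes "0 \<le> \<rho>'" "\<rho>' < \<rho>"
  obtains C where "C > 0"
    "\<And>n u. \<rho>' ^ n * norm (cut (\<lambda>z. \<rho> \<le> cmod z) u) \<le> C * norm (matpow A n *v u)"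
proof -
  let ?S = "\<lambda>z. \<rho> \<le> cmod z"
  obtain C where C: "C > 0"
    "\<And>n x. x \<in> spec_space ?S \<Longrightarrow> \<rho>' ^ n * norm x \<le> C * norm (matpow A n *v x)"
    using growth_lower[of ?S \<rho> \<rho>'] assms by blast
  obtain K where K: "K > 0" "\<And>x. norm (cut ?S x) \<le> K * norm x"
    using cut_bound by blast
  have "\<rho>' ^ n * norm (cut ?S u) \<le> (C * K) * norm (matpow A n *v u)" for n u
  proof -
    have "\<rho>' ^ n * norm (cut ?S u) \<le> C * norm (cut ?S (matpow A n *v u))"
      using C(2)[OF cut_in] by (simp add: cut_matpow_A)
    also have "\<dots> \<le> C * (K * norm (matpow A n *v u))"
      using C(1) K(2) by (intro mult_left_mono) auto
    finally show ?thesis by (simp add: mult.assoc)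
  qed
  then show ?thesis using C(1) K(1) that[of "C * K"] by simp
qed

text \<open>Above, growth on the whole subspace bounds the orbit; below, the non-zero component of
  modulus at least \<open>\<rho>\<close> does. Constants disappear since their \<open>n\<close>-th
  roots tend to 1.\<close>

lemma tendsto_root_norm:
  assumes \<rho>: "\<rho> \<ge> 0" and x: "x \<in> spec_space (\<lambda>z. cmod z \<le> \<rho>)" "x \<notin> spec_space (\<lambda>z. cmod z < \<rho>)"
  shows "(\<lambda>n. root n (norm (matpow A n *v x))) \<longlonglongrightarrow> \<rho>"
proof (rule order_tendstoI)
  have root_eq: "root n (c * r ^ n) = root n c * r" if "n > 0" "r \<ge> 0" for n c and r :: real
    using that by (simp add: real_root_mult real_root_power_cancel)
  have root_lim: "(\<lambda>n. root n c * r) \<longlonglongrightarrow> r" if "c > 0" for c r :: real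
    using tendsto_mult_right[OF LIMSEQ_root_const[OF that], of r] by simp
  {
    fix y assume y: "y < \<rho>"
    show "\<forall>\<^sub>F n in sequentially. y < root n (norm (matpow A n *v x))"
    proof (cases "y < 0")
      case True
      \<comment> \<open>Roots of norms are nonnegative. For \<open>\<rho> = 0\<close> only this case
        arises.\<close>
      then show ?thesis
        by (intro always_eventually allI) (smt (verit) norm_ge_zero real_root_pos_pos_le)
    next
      case False
      define r where "r = (y + \<rho>) / 2"
      have r: "0 \<le> r" "y < r" "r < \<rho>" using False y by (auto simp: r_def)
      let ?S = "\<lambda>z. \<rho> \<le> cmod z"
      obtain C where C: "C > 0" "\<And>n u. r ^ n * norm (cut ?S u) \<le> C * norm (matpow A n *v u)"
        using cut_growth_lower[OF r(1,3)] by blast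
      define c where "c = norm (cut ?S x) / C"
      have "c > 0" using C(1) x(2) by (simp add: c_def cut_eq_0_iff not_le)
      have low: "c * r ^ n \<le> norm (matpow A n *v x)" for n
        using C(2)[of n x] C(1) by (simp add: c_def field_simps)
      have "\<forall>\<^sub>F n in sequentially. y < root n c * r"
        by (rule order_tendstoD[OF root_lim[OF \<open>c > 0\<close>] r(2)])
      then show ?thesis
        using eventually_gt_at_top[of 0]
      proof eventually_elim
        case (elim n)
        have "root n c * r \<le> root n (norm (matpow A n *v x))"
          using low[of n] elim r by (subst root_eq[symmetric]) auto
        then show ?case using elim by linarith
      qed
    qed
  next
    fix y assume y: "\<rho> < y"
    define r where "r = (y + \<rho>) / 2"
    have r: "0 \<le> r" "r < y" "\<rho> < r" using \<rho> y by (auto simp: r_def)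
    obtain C where C: "C > 0" "\<And>n x. x \<in> spec_space (\<lambda>z. cmod z \<le> \<rho>) \<Longrightarrow>
        norm (matpow A n *v x) \<le> C * r ^ n * norm x"
      using growth_upper[of "\<lambda>z. cmod z \<le> \<rho>" \<rho> r] \<rho> r by blast
    define c where "c = C * norm x"
    have "x \<noteq> 0" using x(2) by (auto simp: spec_space_def crd_simps)
    then have "c > 0" using C(1) by (simp add: c_def)
    have up: "norm (matpow A n *v x) \<le> c * r ^ n" for n
      using C(2)[OF x(1), of n] by (simp add: c_def mult_ac)
    have "\<forall>\<^sub>F n in sequentially. root n c * r < y"
      by (rule order_tendstoD[OF root_lim[OF \<open>c > 0\<close>] r(2)])
    then show "\<forall>\<^sub>F n in sequentially. root n (norm (matpow A n *v x)) < y"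
      using eventually_gt_at_top[of 0]
    proof eventually_elim
      case (elim n)
      have "root n (norm (matpow A n *v x)) \<le> root n c * r"
        using up[of n] elim r by (subst root_eq[symmetric]) auto
      then show ?case using elim by linarith
    qed
  }
qed

text \<open>By the growth bound with rate \<open>\<rho> / 2 > 0\<close>, powers of \<open>A\<close>
  are injective where all moduli are at least \<open>\<rho>\<close>, so the component separating the
  two subspaces stays non-zero.\<close>

lemma matpow_spec_layer:
  assumes \<rho>: "\<rho> > 0" and x: "x \<in> spec_space (\<lambda>z. cmod z \<le> \<rho>) - spec_space (\<lambda>z. cmod z < \<rho>)"
  shows "matpow A l *v x \<in> spec_space (\<lambda>z. cmod z \<le> \<rho>) - spec_space (\<lambda>z. cmod z < \<rho>)"
proof -
  let ?S = "\<lambda>z. \<rho> \<le> cmod z"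
  have lt: "v \<in> spec_space (\<lambda>z. cmod z < \<rho>) \<longleftrightarrow> cut ?S v = 0" for v
    by (simp add: cut_eq_0_iff not_le)
  have False if "cut ?S (matpow A l *v x) = 0"
  proof -
    obtain C where "C > 0" and
        C: "\<And>n x. x \<in> spec_space ?S \<Longrightarrow> (\<rho> / 2) ^ n * norm x \<le> C * norm (matpow A n *v x)"
      using growth_lower[of ?S \<rho> "\<rho> / 2"] \<rho> by auto
    from C[OF cut_in, of l x] have "cut ?S x = 0"
      using that zero_less_power[of "\<rho> / 2" l] \<rho>
      by (auto simp: cut_matpow_A mult_le_0_iff simp del: zero_less_power)
    then show False using x lt by blast
  qed
  then show ?thesis using x lt spec_space_matpow_A by blast
qed

text \<open>For fixed \<open>\<epsilon>\<close> the deviation estimate with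
  \<open>X = matpow A n\<close> has two error terms decaying geometrically in \<open>n\<close>; what
  remains is at most \<open>\<epsilon> * norm x\<close>.\<close>

lemma tendsto_psd_powr_vec:
  assumes \<rho>: "\<rho> \<ge> 0" and x: "x \<in> spec_space (\<lambda>z. cmod z \<le> \<rho>)"
    and orth: "\<And>v. v \<in> spec_space (\<lambda>z. cmod z < \<rho>) \<Longrightarrow> v \<bullet> x = 0"
  shows "(\<lambda>n. psd_powr (matrix_abs (matpow A n)) (1 / real n) *v x) \<longlonglongrightarrow> \<rho> *\<^sub>R x"
proof -
  let ?d = "\<lambda>n. norm (psd_powr (matrix_abs (matpow A n)) (1 / real n) *v x - \<rho> *\<^sub>R x)"
  let ?S = "\<lambda>z. \<rho> \<le> cmod z"
  have "\<exists>z. z \<longlonglongrightarrow> 0 \<and> (\<forall>n\<ge>1. (?d n)\<^sup>2 \<le> \<epsilon>\<^sup>2 * (norm x)\<^sup>2 + z n)"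
    if \<epsilon>: "\<epsilon> > 0" "\<rho> = 0 \<or> \<epsilon> < \<rho>" for \<epsilon>
  proof -
    \<comment> \<open>Actual growth rate divided by the threshold for high singular values.\<close>
    define \<theta> where "\<theta> = (\<rho> + \<epsilon> / 2) / (\<rho> + \<epsilon>)"
    have \<theta>: "\<bar>\<theta>\<bar> < 1" using \<rho> \<epsilon>(1) by (simp add: \<theta>_def)
    obtain C where C: "C > 0" "\<And>n x. x \<in> spec_space (\<lambda>z. cmod z \<le> \<rho>) \<Longrightarrow>
        norm (matpow A n *v x) \<le> C * (\<rho> + \<epsilon> / 2) ^ n * norm x"
      using growth_upper[of "\<lambda>z. cmod z \<le> \<rho>" \<rho> "\<rho> + \<epsilon> / 2"] \<rho> \<epsilon> by auto
    have up: "(norm (matpow A n *v x) / (\<rho> + \<epsilon>) ^ n)\<^sup>2 \<le> (C * norm x * \<theta> ^ n)\<^sup>2" for n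
    proof (rule power_mono)
      have "norm (matpow A n *v x) / (\<rho> + \<epsilon>) ^ n \<le> (C * (\<rho> + \<epsilon> / 2) ^ n * norm x) / (\<rho> + \<epsilon>) ^ n"
        using C(2)[OF x, of n] \<rho> \<epsilon> by (intro divide_right_mono) auto
      then show "norm (matpow A n *v x) / (\<rho> + \<epsilon>) ^ n \<le> C * norm x * \<theta> ^ n"
        by (simp add: \<theta>_def power_divide mult_ac)
    qed (use \<rho> \<epsilon> in auto)
    obtain \<eta> c where \<eta>: "\<bar>\<eta>\<bar> < 1"
      and low: "\<And>n. n \<ge> 1 \<Longrightarrow> (?d n)\<^sup>2 \<le> \<epsilon>\<^sup>2 * (norm x)\<^sup>2
          + (\<rho> + \<epsilon>)\<^sup>2 * (norm (matpow A n *v x) / (\<rho> + \<epsilon>) ^ n)\<^sup>2 + \<rho>\<^sup>2 * (c * \<eta> ^ n)\<^sup>2"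
    proof (cases "\<rho> = 0")
      case True
      show ?thesis
      proof (rule that[of 0 0])
        fix n :: nat assume "n \<ge> 1"
        from root_abs_deviation[OF this \<epsilon>(1) \<rho>, of 0 x "matpow A n"] True \<epsilon>(1)
        show "(?d n)\<^sup>2 \<le> \<epsilon>\<^sup>2 * (norm x)\<^sup>2
          + (\<rho> + \<epsilon>)\<^sup>2 * (norm (matpow A n *v x) / (\<rho> + \<epsilon>) ^ n)\<^sup>2 + \<rho>\<^sup>2 * (0 * 0 ^ n)\<^sup>2"
          by simp
      qed simp
    next
      case False
      then have r: "0 < \<rho> - \<epsilon>" "0 < \<rho> - \<epsilon> / 2" "\<rho> - \<epsilon> / 2 < \<rho>" using \<epsilon> by auto
      obtain C' where C': "C' > 0"
        "\<And>n u. (\<rho> - \<epsilon> / 2) ^ n * norm (cut ?S u) \<le> C' * norm (matpow A n *v u)"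
        using cut_growth_lower[OF _ r(3)] r(2) by auto
      \<comment> \<open>The ratio of the threshold for low singular values to a guaranteed rate of
        expansion.\<close>
      show ?thesis
      proof (rule that[of "(\<rho> - \<epsilon>) / (\<rho> - \<epsilon> / 2)" "C' * norm x"])
        show "\<bar>(\<rho> - \<epsilon>) / (\<rho> - \<epsilon> / 2)\<bar> < 1" using r \<epsilon>(1) by simp
      next
        fix n :: nat assume n: "n \<ge> 1"
        define b where "b = C' * norm x / (\<rho> - \<epsilon> / 2) ^ n"
        have "b \<ge> 0" using C'(1) r by (simp add: b_def)
        have "u \<bullet> x \<le> b * norm (matpow A n *v u)" for u
        proof -
          \<comment> \<open>Only the component of \<open>u\<close> of modulus at least
            \<open>\<rho>\<close> contributes to \<open>u \<bullet> x\<close>, and this component is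
            expanded by \<open>A\<close>.\<close>
          have "(u - cut ?S u) \<bullet> x = 0"
            using orth diff_cut_in[of u ?S] by (simp add: not_le)
          then have "u \<bullet> x = cut ?S u \<bullet> x" by (simp add: inner_diff_left)
          also have "\<dots> \<le> norm (cut ?S u) * norm x" by (rule norm_cauchy_schwarz)
          also have "\<dots> \<le> (C' * norm (matpow A n *v u) / (\<rho> - \<epsilon> / 2) ^ n) * norm x"
            using C'(2)[of n u] r by (intro mult_right_mono) (simp_all add: field_simps)
          also have "\<dots> = b * norm (matpow A n *v u)" by (simp add: b_def)
          finally show ?thesis .
        qed
        from root_abs_deviation[OF n \<epsilon>(1) \<rho> \<open>b \<ge> 0\<close> this]
        show "(?d n)\<^sup>2 \<le> \<epsilon>\<^sup>2 * (norm x)\<^sup>2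
          + (\<rho> + \<epsilon>)\<^sup>2 * (norm (matpow A n *v x) / (\<rho> + \<epsilon>) ^ n)\<^sup>2
          + \<rho>\<^sup>2 * (C' * norm x * ((\<rho> - \<epsilon>) / (\<rho> - \<epsilon> / 2)) ^ n)\<^sup>2"
          by (simp add: b_def power_divide)
      qed
    qed
    let ?z = "\<lambda>n. (\<rho> + \<epsilon>)\<^sup>2 * (C * norm x * \<theta> ^ n)\<^sup>2 + \<rho>\<^sup>2 * (c * \<eta> ^ n)\<^sup>2"
    have "?z \<longlonglongrightarrow> (\<rho> + \<epsilon>)\<^sup>2 * (C * norm x * 0)\<^sup>2 + \<rho>\<^sup>2 * (c * 0)\<^sup>2"
      using \<theta> \<eta> by (intro tendsto_intros LIMSEQ_power_zero) auto
    moreover have "(?d n)\<^sup>2 \<le> \<epsilon>\<^sup>2 * (norm x)\<^sup>2 + ?z n" if "n \<ge> 1" for n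
      using low[OF that] mult_left_mono[OF up[of n], of "(\<rho> + \<epsilon>)\<^sup>2"] by simp
    ultimately show ?thesis by (intro exI[of _ ?z]) auto
  qed
  note bound = this
  show ?thesis
  proof (rule LIMSEQ_I)
    fix e :: real assume e: "e > 0"
    \<comment> \<open>The first entry makes \<open>\<epsilon> * norm x\<close> at most
      \<open>e / 2\<close>, with the added 1 guarding against \<open>x = 0\<close>; the second keeps
      \<open>\<epsilon>\<close> below a positive \<open>\<rho>\<close>.\<close>
    define \<epsilon> where "\<epsilon> = min (e / (2 * (norm x + 1))) (if \<rho> = 0 then 1 else \<rho> / 2)"
    have \<epsilon>: "\<epsilon> > 0" "\<rho> = 0 \<or> \<epsilon> < \<rho>"
      using e \<rho> by (auto simp: \<epsilon>_def min_less_iff_disj add_nonneg_pos)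
    have "\<epsilon> * norm x \<le> e / 2"
    proof -
      have "\<epsilon> * norm x \<le> (e / (2 * (norm x + 1))) * (norm x + 1)"
        using e by (intro mult_mono) (auto simp: \<epsilon>_def)
      also have "\<dots> = e / 2"
      proof -
        have "e / (2 * m) * m = e / 2" if "m > 0" for m using that by simp
        from this[of "norm x + 1"] show ?thesis by (simp only: add_nonneg_pos norm_ge_zero zero_less_one)
      qed
      finally show ?thesis .
    qed
    then have "(\<epsilon> * norm x)\<^sup>2 \<le> (e / 2)\<^sup>2" using \<epsilon> by (intro power_mono) auto
    then have half: "\<epsilon>\<^sup>2 * (norm x)\<^sup>2 \<le> e\<^sup>2 / 4" by (simp add: power_mult_distrib power_divide)
    obtain z where z: "z \<longlonglongrightarrow> 0" "\<And>n. n \<ge> 1 \<Longrightarrow> (?d n)\<^sup>2 \<le> \<epsilon>\<^sup>2 * (norm x)\<^sup>2 + z n"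
      using bound[OF \<epsilon>] by blast
    have "\<forall>\<^sub>F n in sequentially. z n < e\<^sup>2 / 4"
      using e by (intro order_tendstoD[OF z(1)]) auto
    then have "\<forall>\<^sub>F n in sequentially. ?d n < e"
      using eventually_ge_at_top[of 1]
    proof eventually_elim
      case (elim n)
      have "(?d n)\<^sup>2 < e\<^sup>2" 
        using z(2)[OF elim(2)] half elim(1) zero_less_power[OF e, of 2] by linarith
      then show ?case using e by (simp add: power_less_imp_less_base)
    qed
    then show "\<exists>no. \<forall>n\<ge>no. ?d n < e" by (simp add: eventually_sequentially)
  qed
qed

end

section \<open>The filtration by moduli and its orthogonal projections\<close>

text \<open>For \<open>a j = 0\<close> the difference of ranges consists of the non-zero vectors
  killed by some power of \<open>A\<close>. A power of \<open>A\<close> may send such a vector to 0,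
  so in that case invariance is stated with 0 adjoined.\<close>

theorem theorem3p8:
  fixes A D N :: "complex^'m^'m"
    and a :: "nat \<Rightarrow> real"
    and k :: nat
    and E :: "nat \<Rightarrow> complex^'m^'m"
  assumes moduli: "a ` {1..k} = {cmod l | l. eigenvalue A l}"
    and increasing: "strict_mono_on {1..k} a"
    and decomposition: "jordan_chevalley A D N"
    and E_zero: "E 0 = 0"
    and E_proj: "\<And>j. j \<in> {1..k} \<Longrightarrow>
      E j = orth_proj (vec.span {v. \<exists>l. eigenvector D v l \<and> cmod l \<le> a j})"
  shows "((\<lambda>n. psd_powr (matrix_abs (matpow A n)) (1 / real n))
            \<longlonglongrightarrow> (\<Sum>j=1..k. a j *\<^sub>R (E j - E (j - 1))))
         \<and> psd (\<Sum>j=1..k. a j *\<^sub>R (E j - E (j - 1)))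
       \<and> (\<forall>j\<in>{1..k}. \<forall>x. x \<noteq> 0 \<longrightarrow>
            (x \<in> matrix_range (E j) - matrix_range (E (j - 1)) \<longleftrightarrow>
             (\<lambda>n. root n (norm (matpow A n *v x))) \<longlonglongrightarrow> a j))
       \<and> (\<forall>j\<in>{1..k}. \<forall>l\<ge>1.
            (a j \<noteq> 0 \<longrightarrow>
               invariant_under (matpow A l) (matrix_range (E j) - matrix_range (E (j - 1)))) \<and>
            (a j = 0 \<longrightarrow>
               invariant_under (matpow A l)
                 (insert 0 (matrix_range (E j) - matrix_range (E (j - 1))))))"
proof -
  obtain P L :: "complex^'m^'m" where PL: "invertible P" "\<And>i j. i \<noteq> j \<Longrightarrow> L $ i $ j = 0" "D = P ** L ** matrix_inv P"
    using decomposition unfolding jordan_chevalley_def diagonalizable_def by blast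
  obtain r where r: "matpow N r = 0"
    using decomposition unfolding jordan_chevalley_def nilpotent_def by blast
  interpret jordan_coords A D N P L r
    using PL r decomposition by unfold_locales (auto simp: jordan_chevalley_def)
  define Vle where "Vle = (\<lambda>\<rho>. spec_space (\<lambda>z. cmod z \<le> \<rho>))"
  define Vlt where "Vlt = (\<lambda>\<rho>. spec_space (\<lambda>z. cmod z < \<rho>))"
  have a0: "0 \<le> a j" if "j \<in> {1..k}" for j
  proof -
    have "a j \<in> {cmod l | l. eigenvalue A l}" using that moduli by blast
    then show ?thesis by auto
  qed
  have lam: "\<exists>j\<in>{1..k}. cmod (lam i) = a j" for i
    using moduli eigenvalue_A_lam[of i] by blast
  have less_iff: "a i < a j \<longleftrightarrow> i < j" if "i \<in> {1..k}" "j \<in> {1..k}" for i j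
    using strict_mono_on_less[OF increasing] that by blast
  \<comment> \<open>The index type is nonempty, so some \<open>lam i\<close> exists.\<close>
  have k: "k \<ge> 1" using lam by fastforce
  have sub: "vec.subspace (Vle \<rho>)" "vec.subspace (Vlt \<rho>)" for \<rho>
    by (simp_all add: Vle_def Vlt_def spec_space_subspace)
  have Vlt_Vle: "Vlt \<rho> \<subseteq> Vle \<rho>" for \<rho>
    unfolding Vlt_def Vle_def spec_space_def by force
  have E: "E j = orth_proj (Vle (a j))" if "j \<in> {1..k}" for j
    using E_proj[OF that] span_eigenvectors_D[of "\<lambda>l. cmod l \<le> a j"] by (simp add: Vle_def)
  have ranE: "matrix_range (E j) = Vle (a j)" if "j \<in> {1..k}" for j
    by (simp add: E[OF that] orth_proj_props sub)
  have Vlt1: "Vlt (a 1) = {0}"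
  proof -
    have "\<not> cmod (lam i) < a 1" for i
      using lam[of i] less_iff[of _ 1] k by fastforce
    then show ?thesis
      unfolding Vlt_def by (intro spec_space_empty) simp
  qed
  \<comment> \<open>No modulus lies strictly between consecutive values of \<open>a\<close>.\<close>
  have Vlt_Suc: "Vlt (a j) = Vle (a (j - 1))" if "j \<in> {1..k}" "j \<noteq> 1" for j
    unfolding Vlt_def Vle_def
  proof (rule spec_space_cong)
    fix i
    obtain p where p: "p \<in> {1..k}" "cmod (lam i) = a p" using lam by blast
    have j: "j - 1 \<in> {1..k}" using that by auto
    show "cmod (lam i) < a j \<longleftrightarrow> cmod (lam i) \<le> a (j - 1)"
      using less_iff[OF p(1) that(1)] less_iff[OF j p(1)] p(2) that by auto
  qed
  have zero: "matrix_range (0 :: complex^'m^'m) = {0}" "cadjoint (0 :: complex^'m^'m) = 0"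
    by (auto simp: matrix_range_def cadjoint_def vec_eq_iff)
  \<comment> \<open>With \<open>Vlt\<close> the case \<open>j = 1\<close>, where
    \<open>E 0 = 0\<close>, takes the same form as all others.\<close>
  have prevE: "E (j - 1) = orth_proj (Vlt (a j))" if "j \<in> {1..k}" for j
  proof (cases "j = 1")
    case True
    then have "E (j - 1) = 0" by (simp add: E_zero)
    moreover have "0 = orth_proj (Vlt (a j))"
    proof (rule orth_proj_unique)
      show "matrix_range 0 = matrix_range (orth_proj (Vlt (a j)))"
        unfolding orth_proj_props(3)[OF sub(2)] using Vlt1 True by (simp add: zero)
    qed (simp_all add: orth_proj_props sub zero)
    ultimately show ?thesis by simp
  next
    case False
    then have "j - 1 \<in> {1..k}" using that by auto
    from E[OF this] Vlt_Suc[OF that False] show ?thesis by simp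
  qed
  have ran_prevE: "matrix_range (E (j - 1)) = Vlt (a j)" if "j \<in> {1..k}" for j
    unfolding prevE[OF that] by (rule orth_proj_props(3)[OF sub(2)])
  \<comment> \<open>The orthogonal projection onto the part of \<open>Vle (a j)\<close> orthogonal
    to \<open>Vlt (a j)\<close>, which is where the vector limit is available.\<close>
  define F where "F = (\<lambda>j. E j - E (j - 1))"
  have F_vec: "F j *v x = orth_proj (Vle (a j)) *v x - orth_proj (Vlt (a j)) *v x"
    if "j \<in> {1..k}" for j x
    unfolding F_def matrix_vector_mult_diff_rdistrib E[OF that] prevE[OF that] ..
  have F_sym: "(F j *v x) \<bullet> y = x \<bullet> (F j *v y)" if "j \<in> {1..k}" for j x y
    by (simp add: F_vec[OF that] inner_diff_left inner_diff_right
        orth_proj_symmetric sub)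
  have F_in: "F j *v x \<in> Vle (a j)" if "j \<in> {1..k}" for j x
    using Vlt_Vle orth_proj_in[OF sub(1), of _ x] orth_proj_in[OF sub(2), of _ x]
    by (simp add: F_vec[OF that] vec.subspace_diff sub subset_iff)
  have F_orth: "v \<bullet> (F j *v x) = 0" if "j \<in> {1..k}" "v \<in> Vlt (a j)" for j v x
  proof -
    have "v \<in> Vle (a j)" using that Vlt_Vle by blast
    then have "F j *v v = 0"
      using that(2) by (simp add: F_vec[OF that(1)] orth_proj_fixes sub)
    then show ?thesis using F_sym[OF that(1), of v x] by simp
  qed
  have F_idem: "F j *v (F j *v x) = F j *v x" if "j \<in> {1..k}" for j x
  proof -
    have "orth_proj (Vlt (a j)) *v (F j *v x) = 0"
      using F_orth[OF that]
      by (intro orth_proj_eq_0 sub) (simp add: inner_commute)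
    moreover have "orth_proj (Vle (a j)) *v (F j *v x) = F j *v x"
      using F_in[OF that] by (simp add: orth_proj_fixes sub)
    ultimately show ?thesis using F_vec[OF that, of "F j *v x"] by simp
  qed
  have Vle_k: "Vle (a k) = UNIV"
  proof -
    have "cmod (lam i) \<le> a k" for i
      using lam[of i] less_iff[of k] by fastforce
    then show ?thesis by (simp add: Vle_def spec_space_def)
  qed
  have F_sum: "(\<Sum>j=1..k. F j *v x) = x" for x
  proof -
    have "(\<Sum>j=1..k. F j *v x) = (\<Sum>j\<in>{Suc 0..k}. E j *v x - E (j - 1) *v x)"
      by (simp add: F_def matrix_vector_mult_diff_rdistrib)
    \<comment> \<open>The sum telescopes, and \<open>E k\<close> is the identity because all moduli
      are at most \<open>a k\<close>.\<close>
    also have "\<dots> = E k *v x - E 0 *v x"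
      by (rule sum_telescope'') (use k in simp)
    also have "\<dots> = x"
      using k by (simp add: E_zero E[of k] orth_proj_fixes sub Vle_k[THEN eqset_imp_iff, simplified])
    finally show ?thesis .
  qed
  let ?M = "\<Sum>j=1..k. a j *\<^sub>R (E j - E (j - 1))"
  have M_vec: "?M *v x = (\<Sum>j=1..k. a j *\<^sub>R (F j *v x))" for x
    by (simp add: matrix_sum_mult_vec scaleR_matrix_mult_vec F_def)
  have "(\<lambda>n. psd_powr (matrix_abs (matpow A n)) (1 / real n)) \<longlonglongrightarrow> ?M"
  proof (rule matrix_tendstoI)
    fix x
    let ?B = "\<lambda>n. psd_powr (matrix_abs (matpow A n)) (1 / real n)"
    have "(\<lambda>n. \<Sum>j=1..k. ?B n *v (F j *v x)) \<longlonglongrightarrow> (\<Sum>j=1..k. a j *\<^sub>R (F j *v x))"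
      using F_in F_orth a0 unfolding Vle_def Vlt_def by (intro tendsto_sum tendsto_psd_powr_vec)
    moreover have "(\<Sum>j=1..k. ?B n *v (F j *v x)) = ?B n *v x" for n
      unfolding linear_sum[OF matrix_vector_mul_linear, symmetric] F_sum ..
    ultimately show "(\<lambda>n. ?B n *v x) \<longlonglongrightarrow> ?M *v x" unfolding M_vec by simp
  qed
  moreover have "psd ?M"
  proof (rule psd_if_hermitian)
    show "(?M *v x) \<bullet> y = x \<bullet> (?M *v y)" for x y
      unfolding M_vec inner_sum_left inner_sum_right by (intro sum.cong) (simp_all add: F_sym)
    have "0 \<le> (F j *v x) \<bullet> x" if "j \<in> {1..k}" for j x
      using F_sym[OF that, of "F j *v x" x] F_idem[OF that, of x] by simp
    then show "0 \<le> (?M *v x) \<bullet> x" for x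
      unfolding M_vec inner_sum_left by (intro sum_nonneg) (simp add: a0)
  qed
  moreover have "x \<in> matrix_range (E j) - matrix_range (E (j - 1)) \<longleftrightarrow>
      (\<lambda>n. root n (norm (matpow A n *v x))) \<longlonglongrightarrow> a j" if j: "j \<in> {1..k}" and x: "x \<noteq> 0" for j x
  proof -
    have lim: "(\<lambda>n. root n (norm (matpow A n *v x))) \<longlonglongrightarrow> a i"
      if "i \<in> {1..k}" "x \<in> Vle (a i) - Vlt (a i)" for i
      using tendsto_root_norm[OF a0[OF that(1)]] that(2) by (simp add: Vle_def Vlt_def)
    \<comment> \<open>The first subspace of the filtration containing \<open>x\<close>. It forces
      the limit \<open>a p\<close>, so uniqueness of limits yields the converse implication.\<close>
    define p where "p = (LEAST p. p \<in> {1..k} \<and> x \<in> Vle (a p))"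
    have ex: "k \<in> {1..k} \<and> x \<in> Vle (a k)" using k by (simp add: Vle_k)
    have p: "p \<in> {1..k}" "x \<in> Vle (a p)"
      using LeastI[of "\<lambda>p. p \<in> {1..k} \<and> x \<in> Vle (a p)", OF ex] by (auto simp: p_def)
    have "x \<notin> Vlt (a p)"
    proof (cases "p = 1")
      case True
      then show ?thesis using Vlt1 x by simp
    next
      case False
      then have "p - 1 < p" "p - 1 \<in> {1..k}" using p(1) by auto
      then have "x \<notin> Vle (a (p - 1))"
        unfolding p_def using not_less_Least by blast
      then show ?thesis using Vlt_Suc[OF p(1) False] by simp
    qed
    then have "x \<in> Vle (a j) - Vlt (a j)" if "(\<lambda>n. root n (norm (matpow A n *v x))) \<longlonglongrightarrow> a j"
      using LIMSEQ_unique[OF that lim[OF p(1)]] p(2) by simp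
    then show ?thesis
      unfolding ranE[OF j] ran_prevE[OF j] using lim[OF j] by blast
  qed
  moreover have "(a j \<noteq> 0 \<longrightarrow>
        invariant_under (matpow A l) (matrix_range (E j) - matrix_range (E (j - 1)))) \<and>
      (a j = 0 \<longrightarrow>
        invariant_under (matpow A l)
          (insert 0 (matrix_range (E j) - matrix_range (E (j - 1)))))" if j: "j \<in> {1..k}" for j l
  proof (intro conjI impI)
    assume "a j \<noteq> 0"
    then have "0 < a j" using a0[OF j] by simp
    then show "invariant_under (matpow A l) (matrix_range (E j) - matrix_range (E (j - 1)))"
      using matpow_spec_layer unfolding ranE[OF j] ran_prevE[OF j] invariant_under_def Vle_def Vlt_def
      by blast
  next
    assume "a j = 0"
    \<comment> \<open>No modulus is below 0, so adjoining 0 restores the whole subspace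
      \<open>Vle (a j)\<close>.\<close>
    then have "Vlt (a j) = {0}"
      unfolding Vlt_def by (intro spec_space_empty) simp
    then have "insert 0 (Vle (a j) - Vlt (a j)) = Vle (a j)"
      using vec.subspace_0[OF sub(1)[of "a j"]] by auto
    then show "invariant_under (matpow A l) (insert 0 (matrix_range (E j) - matrix_range (E (j - 1))))"
      unfolding ranE[OF j] ran_prevE[OF j] invariant_under_def
      by (simp add: Vle_def spec_space_matpow_A)
  qed
  ultimately show ?thesis by blast
qed

end
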